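(* Let $p,p'$ be real numbers with $0<p<1$ and $0<p'<1$. Choose $\omega,\omega'\in\{\pm1\}^{\mathbb Z}$ randomly and independently of each other as follows. The value $\omega_0$ is chosen uniformly from $\{\pm1\}$; the remaining values are then determined by independent random choices so that for every integer $n\ge0$, $\omega_{n+1}=\omega_n$ with probability $p$ (and $\omega_{n+1}=-\omega_n$ otherwise), and $\omega_{-n-1}=\omega_{-n}$ with probability $p$ (and $\omega_{-n-1}=-\omega_{-n}$ otherwise). The sequence $\omega'$ is chosen in the same way with $p'$ in place of $p$. Let $e$ be an edge of the tiling of the plane by unit squares centered at the integer points. Then with probability $1$, the curve through $e$ of the Truchet tiling $[\tau_{\omega,\omega'}]$ is closed.
   Context: Truchet tiles: both tiles are $1\times1$ axis-parallel squares decorated with two disjoint arcs (quarter circles centered at two opposite corners of the square), each joining the midpoints of two adjacent edges. The tile $T_{1}$ has one arc joining the midpoints of the left and top edges and one arc joining the midpoints of the bottom and right edges; the tile $T_{-1}$ has one arc joining the midpoints of the left and bottom edges and one arc joining the midpoints of the top and right edges. For $\tau:\mathbb Z^2\to\{\pm1\}$, the Truchet tiling $[\tau]$ places a copy of $T_{\tau(m,n)}$ centered at $(m,n)$ for each $(m,n)\in\mathbb Z^2$. The arcs join to form a disjoint collection of simple curves in the plane, called the curves of the tiling; each is either closed or bi-infinite. The curve through an edge $e$ of the square tiling is the one passing through the midpoint of $e$. For $\omega,\omega'\in\{\pm1\}^{\mathbb Z}$, $\tau_{\omega,\omega'}:\mathbb Z^2\to\{\pm1\}$ is defined by $\tau_{\omega,\omega'}(m,n)=\omega_m\omega'_n$.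 *)

theory Defs
  imports "HOL-Probability.Probability"
begin

type_synonym plane = "real \<times> real"

definition unit_square :: "plane set" where
  "unit_square = cbox (- 1/2, - 1/2) (1/2, 1/2)"

text \<open>The quarter circle of the unit square centred at the corner \<open>c\<close>; it joins the midpoints
  of the two edges of the square that meet at \<open>c\<close>.\<close>

definition corner_arc :: "plane \<Rightarrow> plane set" where
  "corner_arc c = {x \<in> unit_square. dist x c = 1/2}"

text \<open>The decoration of the tile of sign \<open>s\<close>. For \<open>s = 1\<close> the arcs are centred at the
  top left and bottom right corners, for \<open>s = -1\<close> at the bottom left and top right ones.
  Other values of \<open>s\<close> are never used.\<close>

definition truchet_tile :: "int \<Rightarrow> plane set" where
  "truchet_tile s =
     (if s = 1 then corner_arc (- 1/2, 1/2) \<union> corner_arc (1/2, - 1/2)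
      else corner_arc (- 1/2, - 1/2) \<union> corner_arc (1/2, 1/2))"

definition truchet_tiling :: "(int \<times> int \<Rightarrow> int) \<Rightarrow> plane set" where
  "truchet_tiling \<tau> =
     (\<Union>(m, n). (+) (real_of_int m, real_of_int n) ` truchet_tile (\<tau> (m, n)))"

text \<open>Edges of the tiling by unit squares centred at the integer points, given by their
  endpoints (lower or left endpoint first).\<close>

definition square_edge :: "plane \<Rightarrow> plane \<Rightarrow> bool" where
  "square_edge a b \<longleftrightarrow>
     (\<exists>m n :: int. a = (real_of_int m + 1/2, real_of_int n + 1/2)) \<and>
     (b = a + (1, 0) \<or> b = a + (0, 1))"

text \<open>The curves of the tiling are the connected components of the union of all arcs.\<close>

definition curve_through :: "(int \<times> int \<Rightarrow> int) \<Rightarrow> plane \<Rightarrow> plane \<Rightarrow> plane set" where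
  "curve_through \<tau> a b = connected_component_set (truchet_tiling \<tau>) (midpoint a b)"

definition closed_curve :: "plane set \<Rightarrow> bool" where
  "closed_curve C \<longleftrightarrow>
     (\<exists>\<gamma>. simple_path \<gamma> \<and> pathfinish \<gamma> = pathstart \<gamma> \<and> path_image \<gamma> = C)"

definition prod_sign :: "(int \<Rightarrow> int) \<Rightarrow> (int \<Rightarrow> int) \<Rightarrow> int \<times> int \<Rightarrow> int" where
  "prod_sign \<omega> \<omega>' = (\<lambda>(m, n). \<omega> m * \<omega>' n)"

primrec sign_walk :: "int \<Rightarrow> (nat \<Rightarrow> bool) \<Rightarrow> nat \<Rightarrow> int" where
  "sign_walk s c 0 = s"
| "sign_walk s c (Suc n) = (if c n then sign_walk s c n else - sign_walk s c n)"

text \<open>The bi-infinite sequence with value \<open>s\<close> at \<open>0\<close> in which \<open>c n\<close> tells whether the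
  values at \<open>n\<close> and \<open>n + 1\<close> agree.\<close>

definition sign_seq :: "int \<Rightarrow> (int \<Rightarrow> bool) \<Rightarrow> int \<Rightarrow> int" where
  "sign_seq s c k =
     (if 0 \<le> k then sign_walk s (\<lambda>n. c (int n)) (nat k)
      else sign_walk s (\<lambda>n. c (- int n - 1)) (nat (- k)))"

definition sign_seq_space :: "(int \<Rightarrow> int) measure" where
  "sign_seq_space = (\<Pi>\<^sub>M k\<in>UNIV. count_space {-1, 1})"

definition seed_space :: "real \<Rightarrow> (int \<times> (int \<Rightarrow> bool)) measure" where
  "seed_space p =
     uniform_count_measure {-1, 1} \<Otimes>\<^sub>M (\<Pi>\<^sub>M k\<in>UNIV. measure_pmf (bernoulli_pmf p))"

text \<open>The law of the random sequence on \<open>{-1, 1}\<^sup>\<int>\<close>.\<close>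

definition random_signs :: "real \<Rightarrow> (int \<Rightarrow> int) measure" where
  "random_signs p = distr (seed_space p) sign_seq_space (\<lambda>(s, c). sign_seq s c)"

lemma sign_seq_0: "sign_seq s c 0 = s"
  by (simp add: sign_seq_def)

lemma sign_seq_step_right:
  "sign_seq s c (int n + 1) = (if c (int n) then sign_seq s c (int n) else - sign_seq s c (int n))"
  by (simp add: sign_seq_def nat_add_distrib)

lemma sign_seq_step_left:
  "sign_seq s c (- int n - 1) =
     (if c (- int n - 1) then sign_seq s c (- int n) else - sign_seq s c (- int n))"
proof -
  have "nat (1 + int n) = Suc n" by simp
  then show ?thesis by (cases n) (simp_all add: sign_seq_def nat_add_distrib)
qed

lemma sign_walk_range: "s \<in> {-1, 1} \<Longrightarrow> sign_walk s c n \<in> {-1, 1}"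
  by (induction n) auto

lemma measurable_sign_walk:
  "(\<lambda>(s, c). sign_walk s (\<lambda>n. c (f n)) n) \<in> measurable (seed_space p) (count_space {-1, 1})"
proof (induction n)
  case 0
  have "fst \<in> measurable (seed_space p) (uniform_count_measure {-1, 1 :: int})"
    unfolding seed_space_def by measurable
  moreover have "measurable (seed_space p) (uniform_count_measure {-1, 1 :: int}) =
      measurable (seed_space p) (count_space {-1, 1})"
    by (rule measurable_cong_sets) (simp_all add: sets_uniform_count_measure)
  ultimately show ?case by (simp add: case_prod_unfold)
next
  case (Suc n)
  have [measurable]: "Measurable.pred (seed_space p) (\<lambda>x. snd x (f n))"
  proof -
    have "(\<lambda>x. snd x (f n)) \<in> measurable (seed_space p) (measure_pmf (bernoulli_pmf p))"
      unfolding seed_space_def by measurable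
    then show ?thesis by simp
  qed
  have [measurable]: "(\<lambda>x. sign_walk (fst x) (\<lambda>n. snd x (f n)) n)
      \<in> measurable (seed_space p) (count_space {-1, 1})"
    using Suc by (simp add: case_prod_unfold)
  have [measurable]: "uminus \<in> measurable (count_space {-1, 1 :: int}) (count_space {-1, 1})"
    by simp
  show ?case by (simp add: case_prod_unfold)
qed

lemma measurable_sign_seq:
  "(\<lambda>(s, c). sign_seq s c) \<in> measurable (seed_space p) sign_seq_space"
  unfolding sign_seq_space_def
proof (rule measurable_PiM_single')
  fix k :: int
  show "(\<lambda>x. (case x of (s, c) \<Rightarrow> sign_seq s c) k) \<in> measurable (seed_space p) (count_space {-1, 1})"
    using measurable_sign_walk[of int "nat k" p]
      measurable_sign_walk[of "\<lambda>n. - int n - 1" "nat (- k)" p]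
    by (cases "0 \<le> k") (simp_all add: sign_seq_def case_prod_unfold)
next
  show "(\<lambda>(s, c). sign_seq s c) \<in> space (seed_space p) \<rightarrow> (\<Pi>\<^sub>E k\<in>UNIV. space (count_space {-1, 1}))"
    using sign_walk_range
    by (fastforce simp: seed_space_def space_pair_measure space_uniform_count_measure sign_seq_def)
qed

lemma prob_space_seed_space: "prob_space (seed_space p)"
proof -
  interpret A: prob_space "uniform_count_measure {-1, 1 :: int}"
    by (rule prob_space_uniform_count_measure) auto
  interpret B: prob_space "\<Pi>\<^sub>M k\<in>(UNIV :: int set). measure_pmf (bernoulli_pmf p)"
    by (intro prob_space_PiM prob_space_measure_pmf)
  interpret pair_prob_space "uniform_count_measure {-1, 1 :: int}"
    "\<Pi>\<^sub>M k\<in>(UNIV :: int set). measure_pmf (bernoulli_pmf p)" ..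
  show ?thesis unfolding seed_space_def by (rule prob_space_axioms)
qed

lemma prob_space_random_signs: "prob_space (random_signs p)"
  unfolding random_signs_def
  by (intro prob_space.prob_space_distr prob_space_seed_space measurable_sign_seq)

end

theory Submission imports Defs begin

text \<open>
  Orient the curves so that they cross the edge between the tiles \<open>(m, n)\<close> and \<open>(m + 1, n)\<close> in the
  horizontal direction \<open>\<omega>' n\<close> and the edge between \<open>(m, n)\<close> and \<open>(m, n + 1)\<close> in the vertical
  direction \<open>\<omega> m\<close>. This flow has the stream function \<open>Y - X\<close> on the corners of the tiles, where \<open>X\<close>
  and \<open>Y\<close> are the walks with steps \<open>\<omega>\<close> and \<open>\<omega>'\<close>, and each curve is a contour of \<open>Y - X\<close>. Suppose
  that, in both directions from the origin, \<open>X\<close> reaches \<open>- N\<close> before \<open>N\<close> and \<open>Y\<close> reaches \<open>N\<close>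
  before \<open>- N\<close>. Then \<open>Y - X\<close> is positive on the boundary of a rectangle, which confines the contours
  of nonpositive level inside it; a bounded curve is closed. The walks are independent persistent
  random walks, and gambler's ruin shows that each of the four exits has probability bounded below
  at all large scales \<open>N\<close>, whatever the past, so almost surely some scale succeeds.
\<close>

section \<open>Persistent random walks\<close>

text \<open>The state is the position \<open>x\<close> together with the upcoming step
  \<open>s\<close>: a persistent walk is Markov only when its next step is included.\<close>

definition walk :: "int \<Rightarrow> int \<Rightarrow> (nat \<Rightarrow> bool) \<Rightarrow> nat \<Rightarrow> int" where
  "walk x s d n = x + (\<Sum>i<n. sign_walk s d i)"

text \<open>With the horizon \<open>n\<close> the event depends on finitely many coins only, so the
  walk can be restarted with fresh coins after time \<open>n\<close>.\<close>

definition hits_low_by :: "nat \<Rightarrow> nat \<Rightarrow> int \<Rightarrow> int \<Rightarrow> (nat \<Rightarrow> bool) \<Rightarrow> bool" where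
  "hits_low_by n N x s d \<longleftrightarrow>
     (\<exists>k\<le>n. walk x s d k = - int N \<and> (\<forall>j\<le>k. walk x s d j < int N))"

definition hits_low :: "nat \<Rightarrow> int \<Rightarrow> int \<Rightarrow> (nat \<Rightarrow> bool) \<Rightarrow> bool" where
  "hits_low N x s d \<longleftrightarrow> (\<exists>n. hits_low_by n N x s d)"

definition stays :: "nat \<Rightarrow> nat \<Rightarrow> int \<Rightarrow> int \<Rightarrow> (nat \<Rightarrow> bool) \<Rightarrow> bool" where
  "stays n N x s d \<longleftrightarrow> (\<forall>k\<le>n. \<bar>walk x s d k\<bar> < int N)"

abbreviation coin_space :: "real \<Rightarrow> (nat \<Rightarrow> bool) measure" where
  "coin_space p \<equiv> \<Pi>\<^sub>M i\<in>UNIV. measure_pmf (bernoulli_pmf p)"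

lemma walk_0 [simp]: "walk x s d 0 = x"
  by (simp add: walk_def)

lemma walk_Suc: "walk x s d (Suc n) = walk x s d n + sign_walk s d n"
  by (simp add: walk_def)

lemma sign_walk_uminus: "sign_walk (- s) d n = - sign_walk s d n"
  by (induction n) auto

lemma sign_walk_case_nat:
  "sign_walk s (case_nat b d) (Suc n) = sign_walk (if b then s else - s) d n"
  by (induction n) auto

lemma walk_case_nat:
  "walk x s (case_nat b d) (Suc n) = walk (x + s) (if b then s else - s) d n"
  unfolding walk_def sum.lessThan_Suc_shift sign_walk_case_nat by simp

lemma sign_walk_comb_seq_le:
  "i \<le> n \<Longrightarrow> sign_walk s (comb_seq n d d') i = sign_walk s d i"
  by (induction i) (auto simp: comb_seq_less)

lemma walk_comb_seq_le: "i \<le> n \<Longrightarrow> walk x s (comb_seq n d d') i = walk x s d i"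
  unfolding walk_def by (intro arg_cong2[where f = "(+)"] sum.cong) (auto simp: sign_walk_comb_seq_le)

lemma sign_walk_comb_seq_add:
  "sign_walk s (comb_seq n d d') (i + n) = sign_walk (sign_walk s d n) d' i"
  by (induction i) (auto simp: sign_walk_comb_seq_le comb_seq_add)

text \<open>The pathwise Markov property: replacing the coins from time \<open>n\<close> on restarts
  the walk from its current position and upcoming step.\<close>

lemma walk_comb_seq_add:
  "walk x s (comb_seq n d d') (i + n) = walk (walk x s d n) (sign_walk s d n) d' i"
  by (induction i) (auto simp: walk_comb_seq_le walk_Suc sign_walk_comb_seq_add)

lemma walk_bound:
  assumes "s \<in> {-1, 1}" shows "\<bar>walk x s d n\<bar> \<le> \<bar>x\<bar> + int n"
proof (induction n)
  case (Suc n)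
  with sign_walk_range[OF assms, of d n] show ?case by (auto simp: walk_Suc)
qed simp

section \<open>Coin sequences and measurability of walk events\<close>

lemma sequence_space_bernoulli: "sequence_space (measure_pmf (bernoulli_pmf p))"
  by (intro sequence_space.intro product_prob_spaceI prob_space_measure_pmf)

lemma space_coin_space [simp]: "space (coin_space p) = UNIV"
  by (auto simp: space_PiM)

lemma prob_space_coin_space: "prob_space (coin_space p)"
  by (intro prob_space_PiM prob_space_measure_pmf)

lemma measurable_flag [measurable]:
  "(\<lambda>d. d k) \<in> measurable (\<Pi>\<^sub>M i\<in>UNIV. measure_pmf (bernoulli_pmf p)) (count_space UNIV)"
  using measurable_component_singleton[of k UNIV "\<lambda>_. measure_pmf (bernoulli_pmf p)"] by simp

lemma measurable_sign_walk_flags [measurable]: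
  "(\<lambda>d. sign_walk s d n) \<in> measurable (coin_space p) (count_space UNIV)"
  by (induction n) auto

lemma measurable_walk [measurable]:
  "(\<lambda>d. walk x s d n) \<in> measurable (coin_space p) (count_space UNIV)"
  by (induction n) (auto simp: walk_Suc)

lemma measurable_hits_low_by [measurable]:
  "Measurable.pred (coin_space p) (hits_low_by n N x s)"
  unfolding hits_low_by_def by measurable

lemma measurable_hits_low [measurable]:
  "Measurable.pred (coin_space p) (hits_low N x s)"
  unfolding hits_low_def by measurable

lemma measurable_stays [measurable]:
  "Measurable.pred (coin_space p) (stays n N x s)"
  unfolding stays_def by measurable

text \<open>First-step analysis: by \<open>PiM_iter\<close>, an independent coin put in front of a
  coin sequence does not change its law, and Fubini conditions on that coin.\<close>

lemma prob_coin_space_step: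
  assumes p: "0 \<le> p" "p \<le> 1" and Q [measurable]: "Measurable.pred (coin_space p) Q"
  shows "measure (coin_space p) {d. Q d} =
    p * measure (coin_space p) {d. Q (case_nat True d)} +
    (1 - p) * measure (coin_space p) {d. Q (case_nat False d)}"
proof -
  interpret sequence_space "measure_pmf (bernoulli_pmf p)"
    by (rule sequence_space_bernoulli)
  let ?B = "measure_pmf (bernoulli_pmf p)"
  have [measurable]: "{d. Q d} \<in> sets S"
    using predE[OF Q] by simp
  have Q': "{x \<in> space (?B \<Otimes>\<^sub>M S). Q (case_nat (fst x) (snd x))} \<in> sets (?B \<Otimes>\<^sub>M S)"
    by measurable
  have "emeasure S {d. Q d} = emeasure (distr (?B \<Otimes>\<^sub>M S) S (\<lambda>(s, \<omega>). case_nat s \<omega>)) {d \<in> space S. Q d}"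
    by (simp add: PiM_iter)
  also have "\<dots> = emeasure (?B \<Otimes>\<^sub>M S) {x \<in> space (?B \<Otimes>\<^sub>M S). Q (case_nat (fst x) (snd x))}"
    by (subst emeasure_distr) (auto simp: case_prod_unfold space_PiM intro!: arg_cong2[where f = emeasure])
  also have "\<dots> = (\<integral>\<^sup>+ b. emeasure S {d. Q (case_nat b d)} \<partial>?B)"
    by (subst P.emeasure_pair_measure_alt[OF Q'])
       (auto intro!: nn_integral_cong arg_cong2[where f = emeasure] simp: space_pair_measure)
  also have "\<dots> = emeasure S {d. Q (case_nat True d)} * p + emeasure S {d. Q (case_nat False d)} * (1 - p)"
    using p by simp
  finally show ?thesis
    using p by (simp add: P.emeasure_eq_measure ennreal_mult[symmetric] ennreal_plus[symmetric] mult.commute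
        del: ennreal_plus)
qed


section \<open>Gambler's ruin for the persistent walk\<close>

lemma atMost_Suc_split:
  "(\<exists>k\<le>Suc n. Q k) \<longleftrightarrow> Q 0 \<or> (\<exists>k\<le>n. Q (Suc k))"
  "(\<forall>k\<le>Suc n. Q k) \<longleftrightarrow> Q 0 \<and> (\<forall>k\<le>n. Q (Suc k))"
  by (metis Suc_le_mono le0 not0_implies_Suc)+

lemma hits_low_by_step:
  assumes "\<bar>x\<bar> < int N"
  shows "hits_low_by (Suc n) N x s (case_nat b d) \<longleftrightarrow>
         hits_low_by n N (x + s) (if b then s else - s) d"
  unfolding hits_low_by_def atMost_Suc_split walk_case_nat using assms by auto

lemma stays_step:
  assumes "\<bar>x\<bar> < int N"
  shows "stays (Suc n) N x s (case_nat b d) \<longleftrightarrow> stays n N (x + s) (if b then s else - s) d"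
  unfolding stays_def atMost_Suc_split walk_case_nat using assms by auto

text \<open>For \<open>b = 1 / (2 - 2 p)\<close> the function \<open>x + b s\<close> of the position \<open>x\<close> and the next step \<open>s\<close> is
  harmonic, and \<open>x\<^sup>2 + 2 b x s\<close> has the constant drift \<open>2 b - 1\<close>.\<close>

lemma prob_hits_or_stays_ge:
  fixes p b :: real
  assumes p: "0 < p" "p < 1" and b: "b = 1 / (2 - 2 * p)"
    and "s \<in> {-1, 1}" "\<bar>x\<bar> \<le> int N" "0 < N"
  shows "(real N - x - b * s - b) / (2 * real N)
    \<le> measure (coin_space p) {d. hits_low_by n N x s d \<or> stays n N x s d}"
  using assms(4,5)
proof (induction n arbitrary: x s)
  interpret prob_space "coin_space p" by (rule prob_space_coin_space)
  have b0: "0 < b" "b * (2 * p - 1) = b - 1" using p by (auto simp: b field_simps)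
  {
    \<comment> \<open>The correction \<open>- b\<close> makes the harmonic function at most 1 at
      \<open>- N\<close> and at most 0 at \<open>N\<close>, whichever sign \<open>s\<close> has, so
      it is a lower bound on the boundary.\<close>
    fix x s :: int and n :: nat
    assume s: "s \<in> {-1, 1}" and x: "\<bar>x\<bar> = int N"
    consider "x = - int N" | "x = int N" using x by linarith
    then have "(real N - x - b * s - b) / (2 * real N)
      \<le> measure (coin_space p) {d. hits_low_by n N x s d \<or> stays n N x s d}"
    proof cases
      case 1
      then have "hits_low_by n N x s d" for d
        using \<open>0 < N\<close> by (auto simp: hits_low_by_def intro!: exI[of _ 0])
      then show ?thesis using 1 \<open>0 < N\<close> b0 s prob_space by (auto simp: field_simps)
    next
      case 2
      have "(real N - x - b * s - b) / (2 * real N) \<le> 0"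
        using 2 \<open>0 < N\<close> b0 s by (auto simp: field_simps)
      then show ?thesis using measure_nonneg order_trans by blast
    qed
  } note boundary = this
  {
    case 0
    show ?case
    proof (cases "\<bar>x\<bar> = int N")
      case False
      then have "stays 0 N x s d" for d using 0 by (auto simp: stays_def)
      then show ?thesis using 0 \<open>0 < N\<close> b0 prob_space by (auto simp: field_simps)
    qed (use boundary 0 in auto)
  next
    case (Suc n)
    show ?case
    proof (cases "\<bar>x\<bar> = int N")
      case False
      then have x: "\<bar>x\<bar> < int N" using Suc.prems by auto
      then have x': "\<bar>x + s\<bar> \<le> int N" using Suc.prems by auto
      define \<phi> where "\<phi> = (\<lambda>x s :: int. (real N - x - b * s - b) / (2 * real N))"
      have "\<phi> x s = (real N - x - (b * s) - b) / (2 * real N)" by (simp add: \<phi>_def)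
      \<comment> \<open>The step after \<open>s\<close> has mean \<open>(2 * p - 1) * s\<close>, so
        the relation \<open>b = 1 + b * (2 * p - 1)\<close> used here is what makes the function
        harmonic.\<close>
      also have "b * real_of_int s = s + b * (2 * p - 1) * s" unfolding b0(2) by (simp add: algebra_simps)
      also have "(real N - x - (s + b * (2 * p - 1) * s) - b) / (2 * real N) =
          p * \<phi> (x + s) s + (1 - p) * \<phi> (x + s) (- s)"
        using \<open>0 < N\<close> by (simp add: \<phi>_def field_simps)
      also have "\<dots> \<le> p * measure (coin_space p) {d. hits_low_by n N (x + s) s d \<or> stays n N (x + s) s d}
          + (1 - p) * measure (coin_space p) {d. hits_low_by n N (x + s) (- s) d \<or> stays n N (x + s) (- s) d}"
        unfolding \<phi>_def using p Suc.prems x' by (intro add_mono mult_left_mono Suc.IH) auto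
      also have "\<dots> = measure (coin_space p) {d. hits_low_by (Suc n) N x s d \<or> stays (Suc n) N x s d}"
        using p by (subst prob_coin_space_step) (auto simp: hits_low_by_step[OF x] stays_step[OF x])
      finally show ?thesis by (simp add: \<phi>_def)
    qed (use boundary Suc.prems in auto)
  }
qed

text \<open>Optional stopping: before the exit, \<open>x\<^sup>2 + 2 * b * x * s\<close> gains
  \<open>2 * b - 1\<close> per step on average, while it stays at most
  \<open>N\<^sup>2 + 2 * b * N\<close>. This bounds the mean exit time, hence \<open>n\<close> times
  the probability of no exit by time \<open>n\<close>.\<close>

lemma prob_stays_le:
  fixes p b :: real
  assumes p: "0 < p" "p < 1" and b: "b = 1 / (2 - 2 * p)"
    and "s \<in> {-1, 1}" "\<bar>x\<bar> \<le> int N"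
  shows "real n * (2 * b - 1) * measure (coin_space p) {d. stays n N x s d}
    \<le> (real N)\<^sup>2 + 2 * b * N - (real_of_int x)\<^sup>2 - 2 * b * x * s"
  using assms(4,5)
proof (induction n arbitrary: x s)
  interpret prob_space "coin_space p" by (rule prob_space_coin_space)
  have b0: "0 < b" "b * (2 * p - 1) = b - 1" using p by (auto simp: b field_simps)
  have b1: "0 < 2 * b - 1" using p by (auto simp: b field_simps)
  define \<psi> where "\<psi> = (\<lambda>x s :: int. (real N)\<^sup>2 + 2 * b * N - (real_of_int x)\<^sup>2 - 2 * b * x * s)"
  have \<psi>_nonneg: "0 \<le> \<psi> x s" if "s \<in> {-1, 1}" "\<bar>x\<bar> \<le> int N" for x s
  proof -
    have "\<bar>real_of_int x\<bar> \<le> real N" using that(2) by linarith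
    then have "(real_of_int x)\<^sup>2 \<le> (real N)\<^sup>2"
      by (metis abs_ge_zero power2_abs power_mono)
    moreover have "x * s \<le> int N" using that by auto
    then have "b * (real_of_int (x * s)) \<le> b * real N"
      using b0 by (intro mult_left_mono) linarith+
    ultimately show ?thesis by (simp add: \<psi>_def)
  qed
  {
    case 0
    then show ?case using \<psi>_nonneg by (simp add: \<psi>_def)
  next
    case (Suc n)
    show ?case
    proof (cases "\<bar>x\<bar> = int N")
      case True
      then have "\<not> stays (Suc n) N x s d" for d by (auto simp: stays_def intro!: exI[of _ 0])
      then show ?thesis using \<psi>_nonneg Suc.prems by (simp add: \<psi>_def)
    next
      case False
      then have x: "\<bar>x\<bar> < int N" using Suc.prems by auto
      then have x': "\<bar>x + s\<bar> \<le> int N" using Suc.prems by auto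
      let ?P = "\<lambda>n x s. measure (coin_space p) {d. stays n N x s d}"
      have P: "?P (Suc n) x s = p * ?P n (x + s) s + (1 - p) * ?P n (x + s) (- s)"
        using p by (subst prob_coin_space_step) (auto simp: stays_step[OF x])
      \<comment> \<open>Of the \<open>Suc n\<close> copies of the probability one is bounded by 1
        and accounts for the drift of the current step; the induction hypothesis handles the other
        \<open>n\<close>.\<close>
      have "(2 * b - 1) * ?P (Suc n) x s \<le> (2 * b - 1) * 1"
        using b1 by (intro mult_left_mono) auto
      then have "real (Suc n) * (2 * b - 1) * ?P (Suc n) x s
          \<le> (2 * b - 1) + real n * (2 * b - 1) * ?P (Suc n) x s"
        by (simp add: algebra_simps)
      also have "real n * (2 * b - 1) * ?P (Suc n) x s =
          p * (real n * (2 * b - 1) * ?P n (x + s) s) + (1 - p) * (real n * (2 * b - 1) * ?P n (x + s) (- s))"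
        unfolding P by (simp add: algebra_simps)
      also have "\<dots> \<le> p * \<psi> (x + s) s + (1 - p) * \<psi> (x + s) (- s)"
        unfolding \<psi>_def using p Suc.prems x' by (intro add_mono mult_left_mono Suc.IH) auto
      also have "\<dots> = (real N)\<^sup>2 + 2 * b * N - (real_of_int (x + s))\<^sup>2 - 2 * (b * (2 * p - 1)) * (x + s) * s"
        by (simp add: \<psi>_def algebra_simps)
      also have "(2 * b - 1) + \<dots> = \<psi> x s"
        using Suc.prems unfolding b0 by (auto simp: \<psi>_def power2_eq_square algebra_simps)
      finally show ?thesis by (simp add: \<psi>_def)
    qed
  }
qed

text \<open>From a start close to 0 on the scale \<open>N\<close> the walk exits low with
  probability near 1/2. The bound on \<open>N\<close> limits the loss caused by \<open>x\<close> and
  \<open>s\<close> to 1/8, and a large \<open>n\<close> limits the probability of no exit to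
  1/8.\<close>

lemma prob_hits_low_by_ge:
  assumes p: "0 < p" "p < 1" and s: "s \<in> {-1, 1}"
    and N: "4 * real_of_int \<bar>x\<bar> + 4 / (1 - p) \<le> real N"
  shows "\<exists>n. 1/4 \<le> measure (coin_space p) {d. hits_low_by n N x s d}"
proof -
  interpret prob_space "coin_space p" by (rule prob_space_coin_space)
  define b where "b = 1 / (2 - 2 * p)"
  have b0: "0 < 2 * b - 1" "0 < b" "4 / (1 - p) = 8 * b"
    using p by (auto simp: b_def field_simps)
  have N0: "0 < N" using N b0 by (cases N) auto
  have x: "\<bar>x\<bar> \<le> int N" using N b0 by linarith
  define C where "C = (real N)\<^sup>2 + 2 * b * N - (real_of_int x)\<^sup>2 - 2 * b * x * s"
  obtain n where n: "8 * C / (2 * b - 1) < real n" using reals_Archimedean2 by blast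
  define P where "P = measure (coin_space p) {d. stays n N x s d}"
  have "real n * (2 * b - 1) * P \<le> C"
    unfolding C_def P_def using prob_stays_le[OF p b_def s x] .
  moreover have "8 * C \<le> real n * (2 * b - 1)" using n b0 by (simp add: field_simps)
  moreover have "real n * (2 * b - 1) * P \<ge> 0" using b0 by (simp add: P_def)
  ultimately have "real n * (2 * b - 1) * P * 8 \<le> real n * (2 * b - 1)" "0 \<le> C" by linarith+
  moreover have "0 < real n" using n b0 \<open>0 \<le> C\<close>
    by (meson divide_nonneg_pos le_less_trans mult_nonneg_nonneg zero_le_numeral)
  ultimately have P: "P \<le> 1/8" using b0 by (simp add: mult.assoc)
  have "3/8 \<le> (real N - x - b * s - b) / (2 * real N)"
    using N b0 s N0 by (auto simp: field_simps)
  also have "\<dots> \<le> measure (coin_space p) {d. hits_low_by n N x s d \<or> stays n N x s d}"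
    by (rule prob_hits_or_stays_ge[OF p b_def s x N0])
  also have "\<dots> \<le> measure (coin_space p) {d. hits_low_by n N x s d} + P"
    using measurable_hits_low_by[THEN predE, of p n N x s] measurable_stays[THEN predE, of p n N x s]
    unfolding P_def Collect_disj_eq by (intro measure_subadditive) auto
  finally show ?thesis using P by (intro exI[of _ n]) linarith
qed


text \<open>Allowing an arbitrary infinite set \<open>K\<close> of scales lets independent walks be combined by Fubini:
  the next walk is given the set of scales at which the previous ones succeed.\<close>

lemma AE_hits_low:
  assumes p: "0 < p" "p < 1" and s: "s \<in> {-1, 1}" and K: "infinite K"
  shows "AE d in coin_space p. \<exists>N\<in>K. hits_low N x s d"
proof -
  interpret sequence_space "measure_pmf (bernoulli_pmf p)"
    by (rule sequence_space_bernoulli)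
  define bad where "bad = (\<lambda>x s M d. \<forall>N. N \<in> K \<longrightarrow> M \<le> N \<longrightarrow> \<not> hits_low N x s d)"
  have bad_meas [measurable]: "Measurable.pred S (bad x s M)" for x s M
    unfolding bad_def by measurable
  have bad_sets: "{d. bad x s M d} \<in> sets S" for x s M
    using predE[OF bad_meas] by simp
  \<comment> \<open>Failure at all scales beyond \<open>M\<close> survives a shift of the starting time at the cost of a larger
    \<open>M\<close>, so the worst failure probability \<open>\<beta>\<close> satisfies \<open>\<beta> \<le> 3/4 \<beta>\<close>.\<close>
  define \<beta> where "\<beta> = (SUP (x, s, M) \<in> UNIV \<times> {-1, 1} \<times> UNIV. emeasure S {d. bad x s M d})"
  have \<beta>_upper: "emeasure S {d. bad x s M d} \<le> \<beta>" if "s \<in> {-1, 1}" for x s M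
    unfolding \<beta>_def using that by (intro SUP_upper2[of "(x, s, M)"]) auto
  have step: "emeasure S {d. bad x s M d} \<le> ennreal (3/4) * \<beta>" if s: "s \<in> {-1, 1}" for x s M
  proof -
    obtain N0 :: nat where N0: "4 * real_of_int \<bar>x\<bar> + 4 / (1 - p) \<le> real N0"
      using real_arch_simple by blast
    obtain N where N: "N \<in> K" "max M N0 \<le> N"
      using K unfolding infinite_nat_iff_unbounded_le by blast
    then have "4 * real_of_int \<bar>x\<bar> + 4 / (1 - p) \<le> real N" using N0 by linarith
    from prob_hits_low_by_ge[OF p s this] obtain n
      where n: "1/4 \<le> measure S {d. hits_low_by n N x s d}" by blast
    \<comment> \<open>At scales beyond \<open>\<bar>x\<bar> + n\<close> the first \<open>n\<close>
      steps cannot reach the upper level, so a success after the restart is a success of the whole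
      walk.\<close>
    define M' where "M' = max M (nat \<bar>x\<bar> + n + 1)"
    have bad_comb: "\<not> hits_low_by n N x s d \<and> bad (walk x s d n) (sign_walk s d n) M' d'"
      if bad: "bad x s M (comb_seq n d d')" for d d'
    proof
      show "\<not> hits_low_by n N x s d"
      proof
        assume "hits_low_by n N x s d"
        then have "hits_low_by n N x s (comb_seq n d d')"
          by (auto simp: hits_low_by_def walk_comb_seq_le)
        then show False using bad N by (auto simp: bad_def hits_low_def)
      qed
      show "bad (walk x s d n) (sign_walk s d n) M' d'"
        unfolding bad_def
      proof (intro allI impI notI)
        fix L assume L: "L \<in> K" "M' \<le> L" and "hits_low L (walk x s d n) (sign_walk s d n) d'"
        then obtain k where k: "walk (walk x s d n) (sign_walk s d n) d' k = - int L"
          "\<And>j. j \<le> k \<Longrightarrow> walk (walk x s d n) (sign_walk s d n) d' j < int L"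
          by (auto simp: hits_low_def hits_low_by_def)
        have "walk x s (comb_seq n d d') j < int L" if "j \<le> k + n" for j
        proof (cases "j \<le> n")
          case True
          then show ?thesis using walk_bound[OF s, of x "comb_seq n d d'" j] L
            by (auto simp: M'_def)
        next
          case False
          then show ?thesis using k(2)[of "j - n"] walk_comb_seq_add[of x s n d d' "j - n"] that by auto
        qed
        then have "hits_low_by (k + n) L x s (comb_seq n d d')"
          using k(1) by (auto simp: hits_low_by_def walk_comb_seq_add intro!: exI[of _ "k + n"])
        then show False using bad L by (auto simp: bad_def hits_low_def M'_def)
      qed
    qed
    have A: "{d. \<not> hits_low_by n N x s d} \<in> sets S"
      using predE[OF pred_intros_logic(2)[OF measurable_hits_low_by[where p = p and n = n and N = N and x = x and s = s]]] by simp
    have B: "{z \<in> space (S \<Otimes>\<^sub>M S). bad x s M (comb_seq n (fst z) (snd z))} \<in> sets (S \<Otimes>\<^sub>M S)"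
      by measurable
    have "measure S {d. \<not> hits_low_by n N x s d} = 1 - measure S {d. hits_low_by n N x s d}"
      using P.prob_neg[of "hits_low_by n N x s"] predE[OF measurable_hits_low_by[where p = p and n = n and N = N and x = x and s = s]] by simp
    then have le: "emeasure S {d. \<not> hits_low_by n N x s d} \<le> ennreal (3/4)"
      using n by (simp add: P.emeasure_eq_measure ennreal_leI)
    have "emeasure S {d. bad x s M d} =
        emeasure (distr (S \<Otimes>\<^sub>M S) S (\<lambda>(\<omega>, \<omega>'). comb_seq n \<omega> \<omega>')) {d. bad x s M d}"
      by (simp add: PiM_comb_seq)
    also have "\<dots> = emeasure (S \<Otimes>\<^sub>M S) {z \<in> space (S \<Otimes>\<^sub>M S). bad x s M (comb_seq n (fst z) (snd z))}"
      using bad_sets by (subst emeasure_distr[OF measurable_comb_seq])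
        (auto simp: case_prod_unfold intro!: arg_cong2[where f = emeasure])
    also have "\<dots> = (\<integral>\<^sup>+ d. emeasure S {d'. bad x s M (comb_seq n d d')} \<partial>S)"
      by (subst P.emeasure_pair_measure_alt[OF B])
         (auto intro!: nn_integral_cong arg_cong2[where f = emeasure] simp: space_pair_measure)
    also have "\<dots> \<le> (\<integral>\<^sup>+ d. \<beta> * indicator {d. \<not> hits_low_by n N x s d} d \<partial>S)"
    proof (intro nn_integral_mono)
      fix d
      have "emeasure S {d'. bad x s M (comb_seq n d d')} \<le> \<beta>" if "\<not> hits_low_by n N x s d"
      proof -
        have "emeasure S {d'. bad x s M (comb_seq n d d')} \<le>
            emeasure S {d'. bad (walk x s d n) (sign_walk s d n) M' d'}"
          using bad_comb bad_sets by (intro emeasure_mono) auto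
        also have "\<dots> \<le> \<beta>" using sign_walk_range[OF s] by (rule \<beta>_upper)
        finally show ?thesis .
      qed
      moreover have "{d'. bad x s M (comb_seq n d d')} = {}" if "hits_low_by n N x s d"
        using bad_comb that by auto
      ultimately show "emeasure S {d'. bad x s M (comb_seq n d d')} \<le>
          \<beta> * indicator {d. \<not> hits_low_by n N x s d} d"
        by (auto simp: indicator_def)
    qed
    also have "\<dots> = \<beta> * emeasure S {d. \<not> hits_low_by n N x s d}"
      by (rule nn_integral_cmult_indicator[OF A])
    also have "\<dots> \<le> \<beta> * ennreal (3/4)" using le by (rule mult_left_mono) simp
    finally show ?thesis by (simp add: mult.commute)
  qed
  have "\<beta> \<le> ennreal (3/4) * \<beta>"
    unfolding \<beta>_def by (rule SUP_least) (use step in \<open>auto simp: \<beta>_def\<close>)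
  \<comment> \<open>Finiteness is needed before cancelling, since infinity satisfies the inequality
    as well.\<close>
  moreover have "\<beta> \<le> 1"
    unfolding \<beta>_def by (rule SUP_least) (auto simp: P.emeasure_le_1)
  then obtain r where r: "0 \<le> r" "\<beta> = ennreal r"
    by (metis ennreal_cases ennreal_one_neq_top top.extremum_unique)
  ultimately have "r \<le> 3/4 * r"
    by (simp add: ennreal_mult[symmetric])
  with r have "\<beta> = 0" by simp
  then have "emeasure S {d. bad x s 0 d} = 0" using \<beta>_upper[OF s, of x 0] by simp
  then have "AE d in S. \<not> bad x s 0 d"
    using bad_sets by (intro AE_I[of _ _ "{d. bad x s 0 d}"]) auto
  then show ?thesis by eventually_elim (auto simp: bad_def)
qed

section \<open>Two-sided walks and their valleys\<close>

definition psum :: "(int \<Rightarrow> int) \<Rightarrow> int \<Rightarrow> int" where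
  "psum \<omega> k = (if 0 \<le> k then \<Sum>i<nat k. \<omega> (int i) else - (\<Sum>i<nat (- k). \<omega> (- int i - 1)))"

text \<open>The indices \<open>k\<close> and \<open>l\<close> will be two opposite sides of the
  confining rectangle. The other two come from a valley of the negated second walk.\<close>

definition valley :: "nat \<Rightarrow> int \<Rightarrow> (int \<Rightarrow> int) \<Rightarrow> bool" where
  "valley N x \<omega> \<longleftrightarrow> (\<exists>k l. k \<le> 0 \<and> 0 \<le> l \<and> x + psum \<omega> k = - int N \<and> x + psum \<omega> l = - int N \<and>
     (\<forall>j. k \<le> j \<longrightarrow> j \<le> l \<longrightarrow> x + psum \<omega> j < int N))"

lemma psum_step: "psum \<omega> (k + 1) = psum \<omega> k + \<omega> k"
proof (cases "0 \<le> k")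
  case True
  then show ?thesis by (simp add: psum_def nat_add_distrib)
next
  case False
  then obtain n where k: "k = - int (Suc n)" by (metis negD not_le)
  show ?thesis by (cases n) (auto simp: psum_def k nat_add_distrib algebra_simps)
qed

lemma psum_bound:
  assumes "\<And>k. \<omega> k \<in> {-1, 1}" shows "\<bar>psum \<omega> k\<bar> \<le> \<bar>k\<bar>"
proof -
  have *: "\<bar>\<Sum>i<n. \<omega> (f i)\<bar> \<le> int n" for n and f :: "nat \<Rightarrow> int"
  proof -
    have "\<bar>\<omega> j\<bar> = 1" for j using assms[of j] by auto
    then show ?thesis using sum_abs[of "\<lambda>i. \<omega> (f i)" "{..<n}"] by simp
  qed
  show ?thesis using *[of int "nat k"] *[of "\<lambda>i. - int i - 1" "nat (- k)"] by (auto simp: psum_def)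
qed

lemma psum_sign_seq_right:
  "x + psum (sign_seq s c) (int n) = walk x s (\<lambda>i. c (int i)) n"
  by (simp add: psum_def walk_def sign_seq_def)

text \<open>The walk to the left is started one step early, at \<open>x + s\<close>, so that its first step \<open>- s\<close> leads
  to \<open>x\<close> and the later ones are the negated signs at \<open>-1, -2, \<dots>\<close>.\<close>

lemma psum_sign_seq_left:
  "x + psum (sign_seq s c) (- int n) = walk (x + s) (- s) (\<lambda>i. c (- int i - 1)) (Suc n)"
proof -
  have "nat (1 + int i) = Suc i" for i by simp
  then have "sign_seq s c (- int i - 1) = sign_walk s (\<lambda>i. c (- int i - 1)) (Suc i)" for i
    by (simp add: sign_seq_def del: sign_walk.simps)
  then show ?thesis
    unfolding walk_def sum.lessThan_Suc_shift sign_walk_uminus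
    by (simp add: psum_def sum_negf del: sign_walk.simps(2))
qed

lemma valley_sign_seq:
  assumes right: "hits_low N x s (\<lambda>i. c (int i))"
    and left: "hits_low N (x + s) (- s) (\<lambda>i. c (- int i - 1))"
    and N: "\<bar>x\<bar> + 1 < int N" and s: "s \<in> {-1, 1}"
  shows "valley N x (sign_seq s c)"
proof -
  obtain n where n: "walk x s (\<lambda>i. c (int i)) n = - int N"
    "\<And>j. j \<le> n \<Longrightarrow> walk x s (\<lambda>i. c (int i)) j < int N"
    using right by (auto simp: hits_low_def hits_low_by_def)
  obtain m where m: "walk (x + s) (- s) (\<lambda>i. c (- int i - 1)) m = - int N"
    "\<And>j. j \<le> m \<Longrightarrow> walk (x + s) (- s) (\<lambda>i. c (- int i - 1)) j < int N"
    using left by (auto simp: hits_low_def hits_low_by_def)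
  \<comment> \<open>The auxiliary start \<open>x + s\<close> lies above \<open>- N\<close>, so the
    hit comes after the extra step and is a hit of the actual left walk.\<close>
  have "m \<noteq> 0" using m(1) N s by (intro notI) auto
  then obtain m' where m': "m = Suc m'" using not0_implies_Suc by blast
  have "x + psum (sign_seq s c) j < int N" if "- int m' \<le> j" "j \<le> int n" for j
  proof (cases "0 \<le> j")
    case True
    then show ?thesis using n(2)[of "nat j"] psum_sign_seq_right[of x s c "nat j"] that by simp
  next
    case False
    then show ?thesis
      using m(2)[of "Suc (nat (- j))"] psum_sign_seq_left[of x s c "nat (- j)"] that m' by simp
  qed
  then show ?thesis
    unfolding valley_def using n(1) m(1) m' psum_sign_seq_right[of x s c n] psum_sign_seq_left[of x s c m']
    by (intro exI[of _ "- int m'"] exI[of _ "int n"]) auto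
qed

section \<open>Independence of the two halves of a coin sequence\<close>

definition int_join :: "(nat \<Rightarrow> 'a) \<Rightarrow> (nat \<Rightarrow> 'a) \<Rightarrow> int \<Rightarrow> 'a" where
  "int_join d d' k = (if 0 \<le> k then d (nat k) else d' (nat (- k - 1)))"

abbreviation int_coin_space :: "real \<Rightarrow> (int \<Rightarrow> bool) measure" where
  "int_coin_space p \<equiv> \<Pi>\<^sub>M k\<in>UNIV. measure_pmf (bernoulli_pmf p)"

lemma measurable_int_join:
  "(\<lambda>(d, d'). int_join d d') \<in> measurable (coin_space p \<Otimes>\<^sub>M coin_space p) (int_coin_space p)"
proof (rule measurable_PiM_single')
  fix k :: int
  show "(\<lambda>x. (case x of (d, d') \<Rightarrow> int_join d d') k)
      \<in> measurable (coin_space p \<Otimes>\<^sub>M coin_space p) (measure_pmf (bernoulli_pmf p))"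
    by (cases "0 \<le> k") (auto simp: int_join_def case_prod_unfold)
qed auto

text \<open>A product measure is determined by its finite cylinders. A cylinder over
  \<open>J\<close> pulls back to a product of cylinders over the nonnegative part \<open>J1\<close>
  and the reflected negative part \<open>J2\<close>, and the probabilities multiply.\<close>

lemma distr_int_join:
  "distr (coin_space p \<Otimes>\<^sub>M coin_space p) (int_coin_space p) (\<lambda>(d, d'). int_join d d') =
   int_coin_space p" (is "?D = _")
proof -
  interpret C: product_prob_space "\<lambda>_ :: int. measure_pmf (bernoulli_pmf p)" UNIV
    by (intro product_prob_spaceI prob_space_measure_pmf)
  interpret S: sequence_space "measure_pmf (bernoulli_pmf p)"
    by (rule sequence_space_bernoulli)
  show ?thesis
  proof (rule C.PiM_eq)
    fix J :: "int set" and E :: "int \<Rightarrow> bool set"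
    assume J: "finite J" "J \<subseteq> UNIV"
    let ?f = "\<lambda>(d, d'). int_join d d'" and ?B = "measure_pmf (bernoulli_pmf p)"
    let ?X = "prod_emb UNIV (\<lambda>_. ?B) J (\<Pi>\<^sub>E j\<in>J. E j)"
    define J1 where "J1 = int -` J"
    define J2 where "J2 = (\<lambda>n. - int n - 1) -` J"
    let ?E = "prod_emb UNIV (\<lambda>_. ?B) J1 (\<Pi>\<^sub>E j\<in>J1. E (int j))"
    let ?F = "prod_emb UNIV (\<lambda>_. ?B) J2 (\<Pi>\<^sub>E j\<in>J2. E (- int j - 1))"
    have fin: "finite J1" "finite J2"
      unfolding J1_def J2_def using J by (auto intro!: finite_vimageI simp: inj_on_def)
    have J_eq: "J = int ` J1 \<union> (\<lambda>n. - int n - 1) ` J2"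
    proof -
      have "j \<in> int ` J1 \<union> (\<lambda>n. - int n - 1) ` J2" if "j \<in> J" for j
      proof (cases "0 \<le> j")
        case True
        then show ?thesis using that by (auto simp: J1_def intro!: image_eqI[of _ _ "nat j"])
      next
        case False
        then show ?thesis using that by (auto simp: J2_def intro!: image_eqI[of _ _ "nat (- j - 1)"])
      qed
      then show ?thesis by (auto simp: J1_def J2_def)
    qed
    have "?f -` ?X \<inter> space (coin_space p \<Otimes>\<^sub>M coin_space p) = ?E \<times> ?F"
      unfolding J_eq by (auto simp: prod_emb_def space_pair_measure PiE_iff int_join_def ball_Un)
    then have "emeasure ?D ?X = emeasure (coin_space p \<Otimes>\<^sub>M coin_space p) (?E \<times> ?F)"
      using J by (subst emeasure_distr[OF measurable_int_join]) (auto intro!: sets_PiM_I)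
    also have "\<dots> = emeasure (coin_space p) ?E * emeasure (coin_space p) ?F"
      using fin by (intro S.P.emeasure_pair_measure_Times) (auto intro!: sets_PiM_I)
    also have "emeasure (coin_space p) ?E = (\<Prod>j\<in>J1. emeasure ?B (E (int j)))"
      using fin by (intro S.emeasure_PiM_emb) auto
    also have "\<dots> = (\<Prod>j\<in>int ` J1. emeasure ?B (E j))"
      by (simp add: prod.reindex)
    also have "emeasure (coin_space p) ?F = (\<Prod>j\<in>J2. emeasure ?B (E (- int j - 1)))"
      using fin by (intro S.emeasure_PiM_emb) auto
    also have "\<dots> = (\<Prod>j\<in>(\<lambda>n. - int n - 1) ` J2. emeasure ?B (E j))"
      by (simp add: prod.reindex inj_on_def)
    also have "(\<Prod>j\<in>int ` J1. emeasure ?B (E j)) * \<dots> = (\<Prod>j\<in>J. emeasure ?B (E j))"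
      unfolding J_eq using fin by (intro prod.union_disjoint[symmetric]) auto
    finally show "emeasure ?D ?X = (\<Prod>j\<in>J. emeasure ?B (E j))" .
  qed simp_all
qed


section \<open>Almost sure existence of valleys\<close>

lemma measurable_sign_seq_space_component:
  "(\<lambda>\<omega>. \<omega> k) \<in> measurable sign_seq_space (count_space UNIV)"
proof -
  have "(\<lambda>\<omega>. \<omega> k) \<in> measurable sign_seq_space (count_space {-1, 1})"
    unfolding sign_seq_space_def by measurable
  then show ?thesis
    by (rule measurable_compose) simp
qed

lemma measurable_int_add:
  fixes f g :: "'a \<Rightarrow> int"
  assumes [measurable]: "f \<in> measurable M (count_space UNIV)" "g \<in> measurable M (count_space UNIV)"
  shows "(\<lambda>x. f x + g x) \<in> measurable M (count_space UNIV)"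
  by measurable

lemma measurable_psum [measurable]:
  "(\<lambda>\<omega>. psum (\<lambda>k. \<sigma> * \<omega> k) k) \<in> measurable sign_seq_space (count_space UNIV)"
proof -
  have *: "(\<lambda>\<omega>. \<Sum>i<n. \<sigma> * \<omega> (f i)) \<in> measurable sign_seq_space (count_space UNIV)"
    for n and f :: "nat \<Rightarrow> int"
  proof (induction n)
    case (Suc n)
    have "(\<lambda>\<omega>. \<sigma> * \<omega> (f n)) \<in> measurable sign_seq_space (count_space UNIV)"
      by (rule measurable_compose[OF measurable_sign_seq_space_component]) simp
    with Suc show ?case unfolding sum.lessThan_Suc by (rule measurable_int_add)
  qed simp
  have "(\<lambda>\<omega>. - (\<Sum>i<n. \<sigma> * \<omega> (f i))) \<in> measurable sign_seq_space (count_space UNIV)"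
    for n and f :: "nat \<Rightarrow> int"
    by (rule measurable_compose[OF *]) simp
  with * show ?thesis by (cases "0 \<le> k") (simp_all add: psum_def)
qed

lemma measurable_valley [measurable]:
  "Measurable.pred sign_seq_space (\<lambda>\<omega>. valley N x (\<lambda>k. \<sigma> * \<omega> k))"
  unfolding valley_def by measurable

text \<open>The two halves of the walk read disjoint sets of coins. Almost every right half succeeds
  at infinitely many scales in \<open>K\<close>; \<open>AE_hits_low\<close>, applied to the left
  half with that set of scales, yields a common one.\<close>

lemma AE_valley_seed:
  assumes p: "0 < p" "p < 1" and s: "s \<in> {-1, 1}" and \<sigma>: "\<sigma> \<in> {-1, 1}" and K: "infinite K"
  shows "AE c in int_coin_space p. \<exists>N\<in>K. valley N x (\<lambda>k. \<sigma> * sign_seq s c k)"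
proof -
  interpret S: prob_space "coin_space p" by (rule prob_space_coin_space)
  interpret SS: pair_prob_space "coin_space p" "coin_space p" ..
  have "sign_seq s \<in> measurable (int_coin_space p) sign_seq_space"
  proof -
    have "Pair s \<in> measurable (int_coin_space p) (seed_space p)"
      unfolding seed_space_def using s by (intro measurable_Pair1') (simp add: space_uniform_count_measure)
    from measurable_compose[OF this measurable_sign_seq] show ?thesis by simp
  qed
  then have meas [measurable]:
    "Measurable.pred (int_coin_space p) (\<lambda>c. \<exists>N\<in>K. valley N x (\<lambda>k. \<sigma> * sign_seq s c k))"
    by (rule measurable_compose) measurable
  note [measurable] = measurable_int_join
  \<comment> \<open>Negating all signs only changes the initial one, since \<open>c\<close> records
    agreements.\<close>
  have eq: "(\<lambda>k. \<sigma> * sign_seq s c k) = sign_seq (\<sigma> * s) c" for c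
    using \<sigma> by (auto simp: sign_seq_def sign_walk_uminus)
  have \<sigma>s: "\<sigma> * s \<in> {-1, 1}" "- (\<sigma> * s) \<in> {-1, 1}" using \<sigma> s by auto
  have "AE d in coin_space p. AE d' in coin_space p.
      \<exists>N\<in>K. valley N x (\<lambda>k. \<sigma> * sign_seq s (int_join d d') k)"
  proof -
    \<comment> \<open>Intersecting over all lower bounds \<open>M\<close> turns one successful scale
      into infinitely many.\<close>
    have "AE d in coin_space p. \<forall>M. \<exists>N\<in>K \<inter> {M<..}. hits_low N x (\<sigma> * s) d"
      unfolding AE_all_countable
    proof
      fix M
      have "infinite (K \<inter> {M<..})"
        using K by (metis finite_Int finite_atMost Compl_atMost Diff_eq Diff_infinite_finite)
      then show "AE d in coin_space p. \<exists>N\<in>K \<inter> {M<..}. hits_low N x (\<sigma> * s) d"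
        by (rule AE_hits_low[OF p \<sigma>s(1)])
    qed
    then show ?thesis
    proof eventually_elim
      case (elim d)
      define K' where "K' = {N \<in> K. \<bar>x\<bar> + 1 < int N \<and> hits_low N x (\<sigma> * s) d}"
      have "infinite K'"
        unfolding infinite_nat_iff_unbounded
      proof
        fix m
        obtain N where "N \<in> K" "max m (nat (\<bar>x\<bar> + 1)) < N" "hits_low N x (\<sigma> * s) d"
          using elim by blast
        then show "\<exists>n>m. n \<in> K'" unfolding K'_def by (intro exI[of _ N]) auto
      qed
      from AE_hits_low[OF p \<sigma>s(2) this, where x = "x + \<sigma> * s"] show ?case
      proof eventually_elim
        case (elim d')
        then obtain N where N: "N \<in> K'" "hits_low N (x + \<sigma> * s) (- (\<sigma> * s)) d'" by blast
        have "valley N x (sign_seq (\<sigma> * s) (int_join d d'))"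
          using N \<sigma>s by (intro valley_sign_seq) (auto simp: K'_def int_join_def)
        then show ?case using N by (auto simp: eq K'_def)
      qed
    qed
  qed
  then have "AE z in coin_space p \<Otimes>\<^sub>M coin_space p.
      \<exists>N\<in>K. valley N x (\<lambda>k. \<sigma> * sign_seq s (case z of (d, d') \<Rightarrow> int_join d d') k)"
    by (intro SS.AE_pair_measure predE[OF measurable_compose[OF measurable_int_join meas]]) simp
  then show ?thesis
    by (subst distr_int_join[symmetric], subst AE_distr_iff[OF measurable_int_join])
       (use predE[OF meas] in auto)
qed

lemma AE_valley:
  assumes p: "0 < p" "p < 1" and \<sigma>: "\<sigma> \<in> {-1, 1}" and K: "infinite K"
  shows "AE \<omega> in random_signs p. \<exists>N\<in>K. valley N x (\<lambda>k. \<sigma> * \<omega> k)"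
proof -
  interpret U: prob_space "uniform_count_measure {-1, 1 :: int}"
    by (rule prob_space_uniform_count_measure) auto
  interpret C: prob_space "int_coin_space p"
    by (intro prob_space_PiM prob_space_measure_pmf)
  interpret UC: pair_prob_space "uniform_count_measure {-1, 1 :: int}" "int_coin_space p" ..
  have meas: "Measurable.pred sign_seq_space (\<lambda>\<omega>. \<exists>N\<in>K. valley N x (\<lambda>k. \<sigma> * \<omega> k))"
    by measurable
  have "AE z in seed_space p. \<exists>N\<in>K. valley N x (\<lambda>k. \<sigma> * (case z of (s, c) \<Rightarrow> sign_seq s c) k)"
    unfolding seed_space_def
  proof (rule UC.AE_pair_measure)
    show "AE s in uniform_count_measure {-1, 1}. AE c in int_coin_space p.
        \<exists>N\<in>K. valley N x (\<lambda>k. \<sigma> * (case (s, c) of (s, c) \<Rightarrow> sign_seq s c) k)"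
      by (rule AE_I2) (use AE_valley_seed[OF p _ \<sigma> K] in \<open>simp add: space_uniform_count_measure\<close>)
    show "{z \<in> space (uniform_count_measure {-1, 1} \<Otimes>\<^sub>M int_coin_space p).
        \<exists>N\<in>K. valley N x (\<lambda>k. \<sigma> * (case z of (s, c) \<Rightarrow> sign_seq s c) k)}
        \<in> sets (uniform_count_measure {-1, 1} \<Otimes>\<^sub>M int_coin_space p)"
      using predE[OF measurable_compose[OF measurable_sign_seq meas]] by (simp add: seed_space_def)
  qed
  then show ?thesis
    unfolding random_signs_def
    by (subst AE_distr_iff[OF measurable_sign_seq]) (use predE[OF meas] in auto)
qed

text \<open>The same conditioning again: the scales at which the first walk has a valley form the
  infinite set offered to the second one.\<close>

lemma AE_valley_pair:
  fixes x :: int and M :: nat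
  assumes p: "0 < p" "p < 1" and p': "0 < p'" "p' < 1"
  shows "AE (\<omega>, \<omega>') in random_signs p \<Otimes>\<^sub>M random_signs p'.
    \<exists>N>M. valley N x \<omega> \<and> valley N 0 (\<lambda>k. - \<omega>' k)"
proof -
  interpret A: prob_space "random_signs p" by (rule prob_space_random_signs)
  interpret B: prob_space "random_signs p'" by (rule prob_space_random_signs)
  interpret AB: pair_prob_space "random_signs p" "random_signs p'" ..
  have sets: "sets (random_signs p) = sets sign_seq_space" for p
    by (simp add: random_signs_def)
  have v:
    "Measurable.pred (random_signs p \<Otimes>\<^sub>M random_signs p') (\<lambda>z. valley N x (\<lambda>k. \<sigma> * fst z k))"
    "Measurable.pred (random_signs p \<Otimes>\<^sub>M random_signs p') (\<lambda>z. valley N x (\<lambda>k. \<sigma> * snd z k))"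
    for N x \<sigma>
    using measurable_compose[OF measurable_fst, of "\<lambda>\<omega>. valley N x (\<lambda>k. \<sigma> * \<omega> k)" "random_signs p" "count_space UNIV" "random_signs p'"]
      measurable_compose[OF measurable_snd, of "\<lambda>\<omega>. valley N x (\<lambda>k. \<sigma> * \<omega> k)" "random_signs p'" "count_space UNIV" "random_signs p"]
      measurable_valley[of N x \<sigma>]
    by (simp_all add: measurable_cong_sets[OF sets refl])
  have "AE \<omega> in random_signs p. \<forall>L. \<exists>N\<in>{L<..}. valley N x (\<lambda>k. 1 * \<omega> k)"
    unfolding AE_all_countable using AE_valley[OF p] infinite_Ioi by blast
  then have "AE \<omega> in random_signs p. AE \<omega>' in random_signs p'.
      \<exists>N>M. valley N x (\<lambda>k. 1 * \<omega> k) \<and> valley N 0 (\<lambda>k. - 1 * \<omega>' k)"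
  proof eventually_elim
    case (elim \<omega>)
    have "infinite {N. M < N \<and> valley N x (\<lambda>k. 1 * \<omega> k)}"
      unfolding infinite_nat_iff_unbounded
    proof
      fix m
      show "\<exists>n>m. n \<in> {N. M < N \<and> valley N x (\<lambda>k. 1 * \<omega> k)}"
        using elim[rule_format, of "max m M"] by auto
    qed
    from AE_valley[OF p' _ this, of "-1" 0] show ?case by (rule eventually_mono) auto
  qed
  then have "AE z in random_signs p \<Otimes>\<^sub>M random_signs p'.
      \<exists>N>M. valley N x (\<lambda>k. 1 * fst z k) \<and> valley N 0 (\<lambda>k. - 1 * snd z k)"
    by (intro AB.AE_pair_measure predE pred_intros_countable pred_intros_logic v) simp_all
  then show ?thesis by (rule eventually_mono) (auto simp: case_prod_unfold)
qed

section \<open>Truchet arcs and closed curves\<close>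

definition quarter :: "real \<Rightarrow> real \<Rightarrow> real \<Rightarrow> plane" where
  "quarter \<alpha> \<beta> t = (\<alpha> / 2 * (1 - sin (pi / 2 * t)), \<beta> / 2 * (1 - cos (pi / 2 * t)))"

lemma corner_arc_iff:
  "(x, y) \<in> corner_arc (a, b) \<longleftrightarrow>
     \<bar>x\<bar> \<le> 1/2 \<and> \<bar>y\<bar> \<le> 1/2 \<and> (x - a)\<^sup>2 + (y - b)\<^sup>2 = 1/4"
proof -
  have "dist (x, y) (a, b) = 1/2 \<longleftrightarrow> (x - a)\<^sup>2 + (y - b)\<^sup>2 = (1/2)\<^sup>2"
    unfolding dist_Pair_Pair dist_real_def power2_abs
    by (metis real_sqrt_eq_iff real_sqrt_abs abs_of_nonneg zero_le_divide_1_iff zero_le_numeral)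
  then show ?thesis
    by (auto simp: corner_arc_def unit_square_def cbox_Pair_eq power2_eq_square)
qed

lemma quarter_start_finish:
  "pathstart (quarter \<alpha> \<beta>) = (\<alpha> / 2, 0)" "pathfinish (quarter \<alpha> \<beta>) = (0, \<beta> / 2)"
  by (simp_all add: pathstart_def pathfinish_def quarter_def)

lemma arc_quarter:
  assumes "\<alpha> \<in> {-1, 1}" "\<beta> \<in> {-1, 1}"
  shows "arc (quarter \<alpha> \<beta>)"
  unfolding arc_def path_def
proof
  show "continuous_on {0..1} (quarter \<alpha> \<beta>)"
    unfolding quarter_def by (intro continuous_intros)
  show "inj_on (quarter \<alpha> \<beta>) {0..1}"
  proof (rule inj_onI)
    fix s t :: real
    assume st: "s \<in> {0..1}" "t \<in> {0..1}" and "quarter \<alpha> \<beta> s = quarter \<alpha> \<beta> t"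
    then have eq: "cos (pi / 2 * s) = cos (pi / 2 * t)"
      using assms by (auto simp: quarter_def)
    have r: "0 \<le> pi / 2 * r \<and> pi / 2 * r \<le> pi" if "r \<in> {0..1}" for r
      using that mult_left_le[of r "pi / 2"] by auto
    have "pi / 2 * s = pi / 2 * t"
      by (rule cos_inj_pi[OF _ _ _ _ eq]) (use r st in blast)+
    then show "s = t" by simp
  qed
qed

lemma path_image_quarter:
  assumes \<alpha>: "\<alpha> \<in> {-1, 1}" and \<beta>: "\<beta> \<in> {-1, 1}"
  shows "path_image (quarter \<alpha> \<beta>) = corner_arc (\<alpha> / 2, \<beta> / 2)"
proof -
  have "quarter \<alpha> \<beta> t \<in> corner_arc (\<alpha> / 2, \<beta> / 2)" if "t \<in> {0..1}" for t
  proof -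
    define s c where "s = sin (pi / 2 * t)" and "c = cos (pi / 2 * t)"
    have t: "0 \<le> pi / 2 * t" "pi / 2 * t \<le> pi / 2"
      using that mult_left_le[of t "pi / 2"] by auto
    have "0 \<le> s" "s \<le> 1" unfolding s_def using t by (auto intro: sin_ge_zero)
    moreover have "0 \<le> c" "c \<le> 1"
      unfolding c_def using cos_ge_zero[of "pi / 2 * t"] t pi_gt_zero by (linarith, simp)
    moreover have "s\<^sup>2 + c\<^sup>2 = 1" by (simp add: s_def c_def)
    moreover have "(\<alpha> / 2 * (1 - s) - \<alpha> / 2)\<^sup>2 + (\<beta> / 2 * (1 - c) - \<beta> / 2)\<^sup>2
        = (\<alpha>\<^sup>2 * s\<^sup>2 + \<beta>\<^sup>2 * c\<^sup>2) / 4"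
      by (simp add: power2_eq_square field_simps)
    moreover have "\<alpha>\<^sup>2 = 1" "\<beta>\<^sup>2 = 1" "\<bar>\<alpha>\<bar> = 1" "\<bar>\<beta>\<bar> = 1" using \<alpha> \<beta> by auto
    ultimately show ?thesis
      unfolding quarter_def s_def[symmetric] c_def[symmetric] corner_arc_iff
      by (simp add: abs_mult)
  qed
  moreover have "z \<in> quarter \<alpha> \<beta> ` {0..1}" if "z \<in> corner_arc (\<alpha> / 2, \<beta> / 2)" for z
  proof -
    obtain x y where z: "z = (x, y)" by (cases z)
    have *: "\<bar>x\<bar> \<le> 1/2" "\<bar>y\<bar> \<le> 1/2" "(x - \<alpha> / 2)\<^sup>2 + (y - \<beta> / 2)\<^sup>2 = 1/4"
      using that by (auto simp: z corner_arc_iff)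
    \<comment> \<open>In the coordinates \<open>1 - 2 * \<beta> * y\<close> and
      \<open>1 - 2 * \<alpha> * x\<close> the corner is the origin and the arc is the unit quarter
      circle in the first quadrant.\<close>
    have "0 \<le> 1 - 2 * \<beta> * y" "0 \<le> 1 - 2 * \<alpha> * x" using * \<alpha> \<beta> by auto
    moreover have "(1 - 2 * \<beta> * y)\<^sup>2 + (1 - 2 * \<alpha> * x)\<^sup>2 = 1"
      using *(3) \<alpha> \<beta> by (auto simp: power2_eq_square field_simps)
    ultimately obtain t where t: "0 \<le> t" "t \<le> pi / 2" "1 - 2 * \<beta> * y = cos t" "1 - 2 * \<alpha> * x = sin t"
      using sincos_total_pi_half by blast
    have "z = quarter \<alpha> \<beta> (t / (pi / 2))"
      using \<alpha> \<beta> t(3,4)[symmetric] by (auto simp: z quarter_def)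
    then show ?thesis using t by (auto intro!: image_eqI[of _ _ "t / (pi / 2)"])
  qed
  ultimately show ?thesis by (auto simp: path_image_def)
qed

text \<open>On the two sides away from the centre one coordinate is already at distance 1 from it,
  more than the radius. On the two sides through the centre the arc meets the side only at its
  midpoint.\<close>

lemma corner_arc_boundary:
  assumes "(x, y) \<in> corner_arc (\<alpha> / 2, \<beta> / 2)" "\<alpha> \<in> {-1, 1}" "\<beta> \<in> {-1, 1}"
    and "\<bar>x\<bar> = 1/2 \<or> \<bar>y\<bar> = 1/2"
  shows "(x, y) \<in> {(\<alpha> / 2, 0), (0, \<beta> / 2)}"
proof -
  have *: "\<bar>x\<bar> \<le> 1/2" "\<bar>y\<bar> \<le> 1/2" "(x - \<alpha> / 2)\<^sup>2 + (y - \<beta> / 2)\<^sup>2 = 1/4"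
    using assms(1) by (auto simp: corner_arc_iff)
  have aux: "v = 0 \<and> u = \<gamma> / 2"
    if "\<bar>u\<bar> = 1/2" "\<bar>v\<bar> \<le> 1/2" "(u - \<gamma> / 2)\<^sup>2 + (v - \<delta> / 2)\<^sup>2 = 1/4" "\<gamma> \<in> {-1, 1}" "\<delta> \<in> {-1, 1}"
    for u v \<gamma> \<delta> :: real
  proof -
    have u: "u = \<gamma> / 2"
    proof (rule ccontr)
      assume "u \<noteq> \<gamma> / 2"
      then have "u = - \<gamma> / 2" using that(1,4) by auto
      then have "(u - \<gamma> / 2)\<^sup>2 = 1" using that(4) by auto
      then show False using that(3) zero_le_power2[of "v - \<delta> / 2"] by linarith
    qed
    with that have "(v - \<delta> / 2)\<^sup>2 = (1/2)\<^sup>2" by (simp add: power2_eq_square)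
    then have "v - \<delta> / 2 = 1/2 \<or> v - \<delta> / 2 = - (1/2)" unfolding power2_eq_iff .
    then show ?thesis using u that(2,5) by auto
  qed
  show ?thesis
    using assms(4)
  proof
    assume "\<bar>x\<bar> = 1/2"
    then show ?thesis using aux[of x y \<alpha> \<beta>] * assms by auto
  next
    assume "\<bar>y\<bar> = 1/2"
    then show ?thesis using aux[of y x \<beta> \<alpha>] * assms by (auto simp: add.commute)
  qed
qed

text \<open>By the parallelogram law the squared distances to two opposite corners add up to at
  least 1, whereas a common point would give 1/2.\<close>

lemma corner_arc_opposite_disjoint:
  assumes "\<alpha> \<in> {-1, 1}" "\<beta> \<in> {-1, 1}"
  shows "corner_arc (\<alpha> / 2, \<beta> / 2) \<inter> corner_arc (- \<alpha> / 2, - \<beta> / 2) = {}"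
proof -
  have False if "(x - \<alpha> / 2)\<^sup>2 + (y - \<beta> / 2)\<^sup>2 = 1/4" "(x - - \<alpha> / 2)\<^sup>2 + (y - - \<beta> / 2)\<^sup>2 = 1/4" for x y
  proof -
    have "2 * x\<^sup>2 + 2 * y\<^sup>2 + (\<alpha>\<^sup>2 + \<beta>\<^sup>2) / 2 =
        ((x - \<alpha> / 2)\<^sup>2 + (y - \<beta> / 2)\<^sup>2) + ((x - - \<alpha> / 2)\<^sup>2 + (y - - \<beta> / 2)\<^sup>2)"
      by (simp add: power2_eq_square field_simps)
    also have "\<dots> = 1/2" unfolding that by simp
    finally have "2 * x\<^sup>2 + 2 * y\<^sup>2 + (\<alpha>\<^sup>2 + \<beta>\<^sup>2) / 2 = 1/2" .
    moreover have "\<alpha>\<^sup>2 = 1" "\<beta>\<^sup>2 = 1" using assms by auto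
    ultimately have "2 * x\<^sup>2 + 2 * y\<^sup>2 < 0" by simp
    then show False using zero_le_power2[of x] zero_le_power2[of y] by linarith
  qed
  then show ?thesis by (auto simp: corner_arc_iff)
qed

text \<open>With the orientation fixed above, the arc \<open>(m, n, True)\<close> enters the tile \<open>(m, n)\<close> horizontally
  and leaves it vertically, and \<open>(m, n, False)\<close> enters vertically and leaves horizontally.\<close>

type_synonym arc_index = "int \<times> int \<times> bool"

section \<open>The oriented arcs of a product tiling\<close>

locale truchet_product =
  fixes u v :: "int \<Rightarrow> int"
  assumes u: "\<And>k. u k \<in> {-1, 1}" and v: "\<And>k. v k \<in> {-1, 1}"
begin

text \<open>Since \<open>u m\<close> depends only on the column and \<open>v n\<close> only on the
  row, the tiles on both sides of an edge agree on the direction in which it is crossed, so each arc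
  has a successor that starts where it ends.\<close>

fun nxt :: "arc_index \<Rightarrow> arc_index" where
  "nxt (m, n, True) = (m, n + u m, False)"
| "nxt (m, n, False) = (m + v n, n, True)"

fun start :: "arc_index \<Rightarrow> plane" where
  "start (m, n, True) = (m - v n / 2, n)"
| "start (m, n, False) = (m, n - u m / 2)"

fun arc_path :: "arc_index \<Rightarrow> real \<Rightarrow> plane" where
  "arc_path (m, n, True) = (+) (real_of_int m, real_of_int n) \<circ> quarter (- v n) (u m)"
| "arc_path (m, n, False) = (+) (real_of_int m, real_of_int n) \<circ> reversepath (quarter (v n) (- u m))"

fun arc_set :: "arc_index \<Rightarrow> plane set" where
  "arc_set (m, n, True) = (+) (real_of_int m, real_of_int n) ` corner_arc (- v n / 2, u m / 2)"
| "arc_set (m, n, False) = (+) (real_of_int m, real_of_int n) ` corner_arc (v n / 2, - u m / 2)"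

lemma uv_real: "real_of_int (u k) \<in> {-1, 1}" "- real_of_int (u k) \<in> {-1, 1}"
  "real_of_int (v k) \<in> {-1, 1}" "- real_of_int (v k) \<in> {-1, 1}"
  using u[of k] v[of k] by auto

lemma index_cases:
  fixes a :: arc_index
  obtains m n where "a = (m, n, True)" | m n where "a = (m, n, False)"
  by (metis (full_types) prod_cases3)

lemma nxt_neq: "nxt a \<noteq> a"
  by (cases a rule: index_cases) auto

lemma inj_nxt: "inj nxt"
proof (rule injI)
  fix a b assume "nxt a = nxt b"
  then show "a = b"
    by (cases a rule: index_cases; cases b rule: index_cases) auto
qed

lemma arc_arc_path: "arc (arc_path a)"
  by (cases a rule: index_cases)
     (simp_all add: arc_translation_eq arc_reversepath arc_quarter uv_real del: insert_iff)

lemma pathstart_arc_path: "pathstart (arc_path a) = start a"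
  by (cases a rule: index_cases) (auto simp: pathstart_translation quarter_start_finish)

lemma pathfinish_arc_path: "pathfinish (arc_path a) = start (nxt a)"
  by (cases a rule: index_cases) (auto simp: pathfinish_translation quarter_start_finish)

lemma path_image_arc_path: "path_image (arc_path a) = arc_set a"
  by (cases a rule: index_cases)
     (auto simp: path_image_translation path_image_quarter[OF uv_real(4,1)] path_image_quarter[OF uv_real(3,2)])

lemma start_inj: "start a = start b \<Longrightarrow> a = b"
proof (cases a rule: index_cases; cases b rule: index_cases)
  fix m n m' n' assume "start a = start b" "a = (m, n, True)" "b = (m', n', True)"
  then show "a = b" by auto
next
  fix m n m' n' assume "start a = start b" "a = (m, n, False)" "b = (m', n', False)"
  then show "a = b" by auto
next
  \<comment> \<open>Midpoints of vertical edges have an integral second coordinate, those of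
    horizontal edges a half-integral one.\<close>
  have *: False if "real_of_int n = n' - u m / 2" for n n' m :: int
  proof -
    from that have "real_of_int (2 * n) = real_of_int (2 * n' - u m)" by simp
    then have "2 * n = 2 * n' - u m" by (simp only: of_int_eq_iff)
    then show False using u[of m] by (auto; presburger)
  qed
  fix m n m' n'
  {
    assume "start a = start b" "a = (m, n, True)" "b = (m', n', False)"
    then show "a = b" using * by auto
  next
    assume "start a = start b" "a = (m, n, False)" "b = (m', n', True)"
    then show "a = b" using * by (metis Pair_inject start.simps)
  }
qed

lemma arc_set_iff:
  "(x, y) \<in> arc_set (m, n, True) \<longleftrightarrow> (x - m, y - n) \<in> corner_arc (- v n / 2, u m / 2)"
  "(x, y) \<in> arc_set (m, n, False) \<longleftrightarrow> (x - m, y - n) \<in> corner_arc (v n / 2, - u m / 2)"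
  by (auto simp: image_iff intro!: bexI[of _ "(x - m, y - n)"])

lemma arc_set_tile:
  "(x, y) \<in> arc_set (m, n, q) \<Longrightarrow> \<bar>x - m\<bar> \<le> 1/2 \<and> \<bar>y - n\<bar> \<le> 1/2"
  by (cases q) (auto simp only: arc_set_iff corner_arc_iff)

lemma arc_set_boundary:
  assumes "(x, y) \<in> arc_set (m, n, q)" "\<bar>x - m\<bar> = 1/2 \<or> \<bar>y - n\<bar> = 1/2"
  shows "(x, y) \<in> {start (m, n, q), start (nxt (m, n, q))}"
proof (cases q)
  case True
  with assms have "(x - m, y - n) \<in> {(- v n / 2, 0), (0, u m / 2)}"
    using uv_real by (intro corner_arc_boundary) (simp_all only: arc_set_iff of_int_minus simp_thms)
  then show ?thesis using True by (auto simp: algebra_simps)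
next
  case False
  with assms have "(x - m, y - n) \<in> {(v n / 2, 0), (0, - u m / 2)}"
    using uv_real by (intro corner_arc_boundary) (simp_all only: arc_set_iff of_int_minus simp_thms)
  then show ?thesis using False by (auto simp: algebra_simps)
qed

text \<open>Distinct tiles meet only in their boundaries, which an arc touches only at its ends, and
  the two arcs of one tile are disjoint. Exchanging \<open>a\<close> and \<open>b\<close> shows that
  the point is an end of both.\<close>

lemma arc_set_Int:
  assumes "a \<noteq> b" "z \<in> arc_set a" "z \<in> arc_set b"
  shows "z \<in> {start a, start (nxt a)}"
proof -
  obtain x y m n q m' n' q' where eqs: "z = (x, y)" "a = (m, n, q)" "b = (m', n', q')"
    by (metis prod_cases3 surj_pair)
  have tiles: "\<bar>x - m\<bar> \<le> 1/2" "\<bar>y - n\<bar> \<le> 1/2" "\<bar>x - m'\<bar> \<le> 1/2" "\<bar>y - n'\<bar> \<le> 1/2"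
    using assms arc_set_tile by (auto simp only: eqs)
  consider "m \<noteq> m'" | "n \<noteq> n'" | "m = m'" "n = n'" "q \<noteq> q'" using assms(1) eqs by auto
  then show ?thesis
  proof cases
    case 1
    then have "\<bar>x - m\<bar> = 1/2" using tiles by linarith
    then show ?thesis using arc_set_boundary[of x y m n q] assms(2) unfolding eqs by blast
  next
    case 2
    then have "\<bar>y - n\<bar> = 1/2" using tiles by linarith
    then show ?thesis using arc_set_boundary[of x y m n q] assms(2) unfolding eqs by blast
  next
    case 3
    then have "(x, y) \<in> arc_set (m, n, True)" "(x, y) \<in> arc_set (m, n, False)"
      using assms(2,3) by (cases q; simp add: eqs)+
    then have False
      unfolding arc_set_iff
      using corner_arc_opposite_disjoint[OF uv_real(3)[of n] uv_real(2)[of m]] by auto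
    then show ?thesis ..
  qed
qed

lemma truchet_tiling_eq: "truchet_tiling (prod_sign u v) = (\<Union>a. arc_set a)"
proof -
  \<comment> \<open>The centres are the top left and bottom right corners exactly when
    \<open>u m = v n\<close>, that is, when the sign is 1.\<close>
  have tile: "truchet_tile (u m * v n) = corner_arc (- v n / 2, u m / 2) \<union> corner_arc (v n / 2, - u m / 2)"
    for m n
    using u[of m] v[of n] by (auto simp: truchet_tile_def)
  have "z \<in> truchet_tiling (prod_sign u v) \<longleftrightarrow> z \<in> (\<Union>a. arc_set a)" for z
  proof -
    have "z \<in> truchet_tiling (prod_sign u v) \<longleftrightarrow>
        (\<exists>m n. z \<in> (+) (real_of_int m, real_of_int n) ` truchet_tile (u m * v n))"
      by (auto simp: truchet_tiling_def prod_sign_def)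
    also have "\<dots> \<longleftrightarrow> (\<exists>m n. z \<in> arc_set (m, n, True) \<or> z \<in> arc_set (m, n, False))"
      by (simp add: tile image_Un)
    also have "\<dots> \<longleftrightarrow> z \<in> (\<Union>a. arc_set a)"
      unfolding UN_iff bex_UNIV split_paired_Ex ex_bool_eq by blast
    finally show ?thesis .
  qed
  then show ?thesis by blast
qed

section \<open>Periodic orbits and closed curves\<close>

lemma closed_arc_set: "closed (arc_set a)"
  by (metis arc_arc_path arc_def closed_path_image path_image_arc_path)

text \<open>Only finitely many tiles come near a point, so the family is locally finite. This will
  serve for an orbit and for its complement.\<close>

lemma closed_Union_arc_set: "closed (\<Union>a\<in>A. arc_set a)"
proof -
  have "locally_finite_in euclidean (arc_set ` A)"
    unfolding locally_finite_in_def
  proof (intro conjI ballI)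
    fix z :: plane
    obtain x y where z: "z = (x, y)" by (cases z)
    let ?F = "{\<lfloor>x\<rfloor> - 3..\<lfloor>x\<rfloor> + 3} \<times> {\<lfloor>y\<rfloor> - 3..\<lfloor>y\<rfloor> + 3} \<times> (UNIV :: bool set)"
    have "{U \<in> arc_set ` A. U \<inter> ball z 1 \<noteq> {}} \<subseteq> arc_set ` ?F"
    proof
      fix U assume "U \<in> {U \<in> arc_set ` A. U \<inter> ball z 1 \<noteq> {}}"
      then obtain a w1 w2 where U: "U = arc_set a" and w: "(w1, w2) \<in> arc_set a" "(w1, w2) \<in> ball z 1"
        by fastforce
      obtain m n q where a: "a = (m, n, q)" by (rule prod_cases3)
      have "\<bar>w1 - m\<bar> \<le> 1/2" "\<bar>w2 - n\<bar> \<le> 1/2" using arc_set_tile w(1) by (auto simp only: a)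
      moreover have "\<bar>x - w1\<bar> < 1" "\<bar>y - w2\<bar> < 1"
        using w(2) dist_fst_le[of z "(w1, w2)"] dist_snd_le[of z "(w1, w2)"]
        by (auto simp: z dist_real_def)
      ultimately have "a \<in> ?F" unfolding a by (auto; linarith)
      then show "U \<in> arc_set ` ?F" unfolding U by blast
    qed
    then have "finite {U \<in> arc_set ` A. U \<inter> ball z 1 \<noteq> {}}"
      by (rule finite_subset) auto
    then show "\<exists>V. openin euclidean V \<and> z \<in> V \<and> finite {U \<in> arc_set ` A. U \<inter> V \<noteq> {}}"
      by (intro exI[of _ "ball z 1"]) auto
  qed auto
  then have "closedin euclidean (\<Union> (arc_set ` A))"
    by (intro closedin_locally_finite_Union) (auto simp: closed_arc_set)
  then show ?thesis by simp
qed

text \<open>The arcs of one minimal period are distinct and join to a simple loop with image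
  \<open>C\<close>. The union \<open>R\<close> of all other arcs is closed and disjoint from
  \<open>C\<close>, so the component of \<open>start a\<close> is exactly \<open>C\<close>.\<close>

lemma closed_curve_of_periodic:
  assumes "0 < k" "(nxt ^^ k) a = a"
  shows "closed_curve (connected_component_set (\<Union>a. arc_set a) (start a))"
proof -
  define k0 where "k0 = (LEAST k. 0 < k \<and> (nxt ^^ k) a = a)"
  have k0: "0 < k0" "(nxt ^^ k0) a = a"
    using LeastI[of "\<lambda>k. 0 < k \<and> (nxt ^^ k) a = a"] assms unfolding k0_def by auto
  have least: "k0 \<le> k" if "0 < k" "(nxt ^^ k) a = a" for k
    unfolding k0_def using that by (intro Least_le) auto
  define b where "b = (\<lambda>i. (nxt ^^ i) a)"
  have nxt_b: "nxt (b i) = b (Suc i)" for i by (simp add: b_def)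
  have b_k0: "b k0 = b 0" using k0 by (simp add: b_def)
  have b_inj: "i = j" if "b i = b j" "i < k0" "j < k0" for i j
  proof -
    have aux: "\<not> (i < j)" if ij: "b i = b j" "j < k0" for i j
    proof
      assume "i < j"
      then have "(nxt ^^ i) ((nxt ^^ (j - i)) a) = (nxt ^^ i) a"
        using ij(1) by (simp add: b_def flip: funpow_add[THEN fun_cong, unfolded o_def])
      then have "(nxt ^^ (j - i)) a = a"
        using inj_fn[OF inj_nxt, of i] by (simp add: inj_eq)
      with least[of "j - i"] \<open>i < j\<close> ij show False by auto
    qed
    show ?thesis using aux[of i j] aux[of j i] that by (metis linorder_neqE_nat)
  qed
  \<comment> \<open>The loop is the open chain \<open>g l\<close> of all arcs but one, closed up by
    the last arc \<open>b (Suc l)\<close>; this needs at least two arcs.\<close>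
  have "k0 \<noteq> 1" using k0(2) nxt_neq[of a] by auto
  then obtain l where l: "k0 = Suc (Suc l)" using k0(1) by (metis One_nat_def gr0_implies_Suc not0_implies_Suc)
  define g where "g = rec_nat (arc_path (b 0)) (\<lambda>i h. h +++ arc_path (b (Suc i)))"
  have g_simps: "g 0 = arc_path (b 0)" "g (Suc i) = g i +++ arc_path (b (Suc i))" for i
    by (simp_all add: g_def)
  have g: "arc (g i) \<and> pathstart (g i) = start (b 0) \<and> pathfinish (g i) = start (b (Suc i)) \<and>
      path_image (g i) = (\<Union>j\<le>i. arc_set (b j))" if "Suc i < k0" for i
    using that
  proof (induction i)
    case 0
    then show ?case
      by (simp add: g_simps arc_arc_path pathstart_arc_path pathfinish_arc_path path_image_arc_path nxt_b)
  next
    case (Suc i)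
    then have IH: "arc (g i)" "pathstart (g i) = start (b 0)" "pathfinish (g i) = start (b (Suc i))"
      "path_image (g i) = (\<Union>j\<le>i. arc_set (b j))" by auto
    \<comment> \<open>A common point is an end of both arcs, and the far end of the new arc is not
      an end of an earlier one because the period is not yet complete.\<close>
    have "z = start (b (Suc i))" if "j \<le> i" "z \<in> arc_set (b j)" "z \<in> arc_set (b (Suc i))" for z j
    proof -
      have "b j \<noteq> b (Suc i)" using b_inj[of j "Suc i"] that(1) Suc.prems by auto
      then have z: "z \<in> {start (b j), start (b (Suc j))}" "z \<in> {start (b (Suc i)), start (b (Suc (Suc i)))}"
        using arc_set_Int[of "b j" "b (Suc i)" z] arc_set_Int[of "b (Suc i)" "b j" z] that nxt_b by auto
      moreover have "b (Suc (Suc i)) \<noteq> b j" "b (Suc (Suc i)) \<noteq> b (Suc j)"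
        using b_inj[of "Suc (Suc i)" j] b_inj[of "Suc (Suc i)" "Suc j"] that(1) Suc.prems by auto
      then have "start (b (Suc (Suc i))) \<noteq> start (b j)" "start (b (Suc (Suc i))) \<noteq> start (b (Suc j))"
        using start_inj by blast+
      ultimately show ?thesis by auto
    qed
    then have "path_image (g i) \<inter> path_image (arc_path (b (Suc i))) \<subseteq> {pathstart (arc_path (b (Suc i)))}"
      by (auto simp: IH path_image_arc_path pathstart_arc_path)
    then have "arc (g (Suc i))"
      unfolding g_simps by (intro arc_join) (auto simp: IH arc_arc_path pathstart_arc_path)
    then show ?case
      by (auto simp: g_simps IH path_image_join path_image_arc_path pathfinish_arc_path
          pathstart_arc_path nxt_b atMost_Suc)
  qed
  define orb where "orb = b ` {..<k0}"
  define C where "C = (\<Union>a\<in>orb. arc_set a)"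
  define \<gamma> where "\<gamma> = g l +++ arc_path (b (Suc l))"
  note gl = g[of l, unfolded l, simplified]
  have b_l: "b (Suc (Suc l)) = b 0" using b_k0 l by simp
  have "path_image (g l) \<inter> path_image (arc_path (b (Suc l))) \<subseteq> {pathstart (g l), pathstart (arc_path (b (Suc l)))}"
  proof
    fix z assume "z \<in> path_image (g l) \<inter> path_image (arc_path (b (Suc l)))"
    then obtain j where j: "j \<le> l" "z \<in> arc_set (b j)" "z \<in> arc_set (b (Suc l))"
      using gl by (auto simp: path_image_arc_path)
    then have "b (Suc l) \<noteq> b j" using b_inj[of j "Suc l"] l by auto
    from arc_set_Int[OF this j(3,2)]
    show "z \<in> {pathstart (g l), pathstart (arc_path (b (Suc l)))}"
      using gl b_l by (auto simp: nxt_b pathstart_arc_path)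
  qed
  then have simple: "simple_path \<gamma>"
    unfolding \<gamma>_def using gl b_l
    by (intro simple_path_join_loop) (auto simp: arc_arc_path pathstart_arc_path pathfinish_arc_path nxt_b)
  have loop: "pathfinish \<gamma> = pathstart \<gamma>"
    unfolding \<gamma>_def using gl b_l by (auto simp: pathfinish_arc_path nxt_b)
  have image: "path_image \<gamma> = C"
  proof -
    have "orb = b ` {..Suc l}" unfolding orb_def l lessThan_Suc_atMost ..
    then show ?thesis
      unfolding \<gamma>_def C_def using gl
      by (auto simp: path_image_join path_image_arc_path pathstart_arc_path atMost_Suc)
  qed
  have a_C: "start a \<in> C"
  proof -
    have "start a \<in> arc_set a"
      using pathstart_in_path_image[of "arc_path a"] by (simp add: pathstart_arc_path path_image_arc_path)
    moreover have "a \<in> orb" unfolding orb_def using k0 by (auto simp: b_def intro!: image_eqI[of _ _ 0])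
    ultimately show ?thesis by (auto simp: C_def)
  qed
  define R where "R = (\<Union>a\<in>-orb. arc_set a)"
  \<comment> \<open>The orbit is closed under predecessors too, by periodicity and injectivity;
    hence no arc outside it is joined to it.\<close>
  have orb_nxt: "nxt c \<in> orb \<longleftrightarrow> c \<in> orb" for c
  proof
    assume "c \<in> orb"
    then obtain i where i: "i < k0" "c = b i" by (auto simp: orb_def)
    then show "nxt c \<in> orb"
      using b_k0 k0(1) by (cases "Suc i = k0") (auto simp: orb_def nxt_b)
  next
    assume "nxt c \<in> orb"
    then obtain i where i: "i < k0" "nxt c = b i" by (auto simp: orb_def)
    then obtain j where "j < k0" "nxt c = b (Suc j)"
      using that[of "Suc l"] that[of "i - 1"] b_k0 l by (cases i) auto
    then show "c \<in> orb"
      using inj_nxt by (auto simp: orb_def nxt_b[symmetric] inj_eq)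
  qed
  have "C \<inter> R = {}"
  proof -
    have False if "c \<in> orb" "d \<notin> orb" "z \<in> arc_set c" "z \<in> arc_set d" for c d z
    proof -
      have "c \<noteq> d" using that by auto
      then have "z \<in> {start c, start (nxt c)}" "z \<in> {start d, start (nxt d)}"
        using arc_set_Int[of c d z] arc_set_Int[of d c z] that by auto
      then have "c = d \<or> c = nxt d \<or> nxt c = d \<or> nxt c = nxt d" by (auto dest: start_inj)
      then show False using that orb_nxt by metis
    qed
    then show ?thesis by (auto simp: C_def R_def)
  qed
  moreover have "(\<Union>a. arc_set a) = C \<union> R" by (auto simp: C_def R_def)
  moreover have "closed C" "closed R" unfolding C_def R_def by (rule closed_Union_arc_set)+
  ultimately have "D \<inter> C = {} \<or> D \<inter> R = {}" if "connected D" "D \<subseteq> (\<Union>a. arc_set a)" for D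
    using connected_closedD[OF that(1), of C R] that(2) by auto
  moreover have "connected_component_set (\<Union>a. arc_set a) (start a) \<inter> C \<noteq> {}"
  proof -
    have "start a \<in> connected_component_set (C \<union> R) (start a)"
      using a_C by (simp add: connected_component_refl)
    then show ?thesis using a_C unfolding \<open>(\<Union>a. arc_set a) = C \<union> R\<close> by blast
  qed
  ultimately have "connected_component_set (\<Union>a. arc_set a) (start a) \<inter> R = {}"
    using connected_connected_component connected_component_subset by meson
  then have "connected_component_set (\<Union>a. arc_set a) (start a) \<subseteq> C"
    using connected_component_subset[of "\<Union>a. arc_set a" "start a"] \<open>(\<Union>a. arc_set a) = C \<union> R\<close>
    by blast
  moreover have "C \<subseteq> connected_component_set (\<Union>a. arc_set a) (start a)"
    using a_C connected_simple_path_image[OF simple] image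
    by (intro connected_component_maximal) (auto simp: C_def)
  ultimately show ?thesis
    unfolding closed_curve_def using simple loop image by (intro exI[of _ \<gamma>]) auto
qed

text \<open>Pigeonhole gives a repetition, and injectivity of \<open>nxt\<close> cancels the initial
  segment, so \<open>a\<close> itself is periodic.\<close>

lemma closed_curve_of_finite_orbit:
  assumes "finite (range (\<lambda>i. (nxt ^^ i) a))"
  shows "closed_curve (connected_component_set (\<Union>a. arc_set a) (start a))"
proof -
  have "\<not> inj (\<lambda>i. (nxt ^^ i) a)"
    using assms finite_imageD infinite_UNIV_nat by blast
  then obtain i j where "i < j" "(nxt ^^ i) a = (nxt ^^ j) a"
    unfolding inj_def by (metis linorder_neqE_nat)
  then have "(nxt ^^ i) ((nxt ^^ (j - i)) a) = (nxt ^^ i) a"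
    by (simp flip: funpow_add[THEN fun_cong, unfolded o_def])
  then have "(nxt ^^ (j - i)) a = a"
    using inj_fn[OF inj_nxt, of i] by (simp add: inj_eq)
  then show ?thesis using \<open>i < j\<close> by (intro closed_curve_of_periodic[of "j - i"]) auto
qed

text \<open>The sum of \<open>Y - X\<close> over the two ends of the edge at which the arc starts, where \<open>X k\<close> and
  \<open>Y l\<close> are the values at the corner \<open>(k - 1/2, l - 1/2)\<close>.\<close>

fun height :: "(int \<Rightarrow> int) \<Rightarrow> (int \<Rightarrow> int) \<Rightarrow> arc_index \<Rightarrow> int" where
  "height X Y (m, n, True) = Y n + Y (n + 1) - 2 * X (if v n = 1 then m else m + 1)"
| "height X Y (m, n, False) = 2 * Y (if u m = 1 then n else n + 1) - X m - X (m + 1)"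

text \<open>The two edges joined by an arc share the corner at its centre. At the other ends of both
  edges \<open>Y - X\<close> differs from its value there by the same amount,
  \<open>u m * v n\<close> up to sign.\<close>

lemma height_nxt:
  assumes X: "\<And>k. X (k + 1) = X k + u k" and Y: "\<And>k. Y (k + 1) = Y k + v k"
  shows "height X Y (nxt a) = height X Y a"
proof (cases a rule: index_cases)
  case (1 m n)
  then show ?thesis using X[of m] Y[of n] Y[of "n - 1"] u[of m] v[of n] by auto
next
  case (2 m n)
  then show ?thesis using X[of m] Y[of n] X[of "m - 1"] u[of m] v[of n] by auto
qed

text \<open>On a boundary edge of the rectangle \<open>Y - X\<close> is at least 1 at both ends, so
  the height there is at least 2. An orbit of height at most 1 therefore never leaves the
  rectangle.\<close>

lemma closed_curve_of_barrier:
  assumes X: "\<And>k. X (k + 1) = X k + u k" and Y: "\<And>k. Y (k + 1) = Y k + v k"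
    and vertical: "\<And>l. l1 \<le> l \<Longrightarrow> l \<le> l2 \<Longrightarrow> X k1 < Y l \<and> X k2 < Y l"
    and horizontal: "\<And>k. k1 \<le> k \<Longrightarrow> k \<le> k2 \<Longrightarrow> X k < Y l1 \<and> X k < Y l2"
    and a: "a \<in> {k1..<k2} \<times> {l1..<l2} \<times> UNIV" "height X Y a \<le> 1"
  shows "closed_curve (connected_component_set (\<Union>a. arc_set a) (start a))"
proof (rule closed_curve_of_finite_orbit)
  let ?F = "{k1..<k2} \<times> {l1..<l2} \<times> (UNIV :: bool set)"
  have step: "nxt b \<in> ?F" if b: "b \<in> ?F" "height X Y b \<le> 1" for b
  proof (cases b rule: index_cases)
    case (1 m n)
    have "height X Y (nxt b) \<le> 1" using b height_nxt[OF X Y] by simp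
    then show ?thesis
      using 1 b(1) u[of m] horizontal[of m] horizontal[of "m + 1"]
      by (auto simp: not_less; smt (verit))
  next
    case (2 m n)
    have "height X Y (nxt b) \<le> 1" using b height_nxt[OF X Y] by simp
    then show ?thesis
      using 2 b(1) v[of n] vertical[of n] vertical[of "n + 1"]
      by (auto simp: not_less; smt (verit))
  qed
  have "(nxt ^^ i) a \<in> ?F \<and> height X Y ((nxt ^^ i) a) \<le> 1" for i
    by (induction i) (use a step height_nxt[OF X Y] in auto)
  then have "range (\<lambda>i. (nxt ^^ i) a) \<subseteq> ?F" by blast
  then show "finite (range (\<lambda>i. (nxt ^^ i) a))" by (rule finite_subset) auto
qed

end

section \<open>Confining the curves\<close>

lemma psum_uminus: "psum (\<lambda>k. - \<omega> k) k = - psum \<omega> k"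
  by (simp add: psum_def sum_negf)

lemma (in truchet_product) ex_start_midpoint:
  assumes a: "a = (real_of_int m + 1/2, real_of_int n + 1/2)"
    and b: "b = a + (1, 0) \<or> b = a + (0, 1)"
  shows "\<exists>i j q. start (i, j, q) = midpoint a b \<and> \<bar>i\<bar> \<le> \<bar>m\<bar> + 1 \<and> \<bar>j\<bar> \<le> \<bar>n\<bar> + 1"
  using b
proof
  assume "b = a + (1, 0)"
  then have "midpoint a b = (real_of_int m + 1, real_of_int n + 1/2)"
    by (simp add: a midpoint_def field_simps)
  \<comment> \<open>Of the two tiles at the edge, the arc starting there lies in the one that the
    flow enters.\<close>
  then have "start (m + 1, if u (m + 1) = 1 then n + 1 else n, False) = midpoint a b"
    using u[of "m + 1"] by auto
  then show ?thesis by (intro exI conjI) (assumption, auto)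
next
  assume "b = a + (0, 1)"
  then have "midpoint a b = (real_of_int m + 1/2, real_of_int n + 1)"
    by (simp add: a midpoint_def field_simps)
  then have "start (if v (n + 1) = 1 then m + 1 else m, n + 1, True) = midpoint a b"
    using v[of "n + 1"] by auto
  then show ?thesis by (intro exI conjI) (assumption, auto)
qed

text \<open>Raising the start of \<open>X\<close> to \<open>x\<close> changes no step but lowers
  \<open>Y - X\<close> near the edge, which brings the height of its curve below the barrier
  supplied by the valleys.\<close>

lemma closed_curve_through_of_valleys:
  assumes signs: "\<And>k. \<omega> k \<in> {-1, 1}" "\<And>k. \<omega>' k \<in> {-1, 1}"
    and a: "a = (real_of_int m + 1/2, real_of_int n + 1/2)"
    and b: "b = a + (1, 0) \<or> b = a + (0, 1)"
    and x: "\<bar>m\<bar> + \<bar>n\<bar> + 4 \<le> x" and N: "x < int N"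
    and valleys: "valley N x \<omega>" "valley N 0 (\<lambda>k. - \<omega>' k)"
  shows "closed_curve (curve_through (prod_sign \<omega> \<omega>') a b)"
proof -
  interpret truchet_product \<omega> \<omega>' by unfold_locales (rule signs)+
  obtain i j q where e: "start (i, j, q) = midpoint a b" "\<bar>i\<bar> \<le> \<bar>m\<bar> + 1" "\<bar>j\<bar> \<le> \<bar>n\<bar> + 1"
    using ex_start_midpoint[OF a b] by blast
  define X where "X = (\<lambda>k. x + psum \<omega> k)"
  obtain k1 k2 where k: "k1 \<le> 0" "0 \<le> k2" "X k1 = - int N" "X k2 = - int N"
    "\<And>k. k1 \<le> k \<Longrightarrow> k \<le> k2 \<Longrightarrow> X k < int N"
    using valleys(1) unfolding valley_def X_def by blast
  obtain l1 l2 where l: "l1 \<le> 0" "0 \<le> l2" "psum \<omega>' l1 = int N" "psum \<omega>' l2 = int N"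
    "\<And>k. l1 \<le> k \<Longrightarrow> k \<le> l2 \<Longrightarrow> - int N < psum \<omega>' k"
    using valleys(2) unfolding valley_def psum_uminus by (auto simp: minus_less_iff)
  note boundX = psum_bound[of \<omega>, OF signs(1)] and boundY = psum_bound[of \<omega>', OF signs(2)]
  have "closed_curve (connected_component_set (\<Union>a. arc_set a) (start (i, j, q)))"
  proof (rule closed_curve_of_barrier)
    show "X (k + 1) = X k + \<omega> k" for k by (simp add: X_def psum_step)
    show "psum \<omega>' (k + 1) = psum \<omega>' k + \<omega>' k" for k by (rule psum_step)
    show "X k1 < psum \<omega>' l \<and> X k2 < psum \<omega>' l" if "l1 \<le> l" "l \<le> l2" for l
      using k(3,4) l(5)[OF that] by simp
    show "X k < psum \<omega>' l1 \<and> X k < psum \<omega>' l2" if "k1 \<le> k" "k \<le> k2" for k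
      using l(3,4) k(5)[OF that] by simp
    \<comment> \<open>Unit steps need at least \<open>N + x\<close> steps from \<open>x\<close> to
      \<open>- N\<close> and at least \<open>N\<close> from 0 to \<open>N\<close>, so the rectangle
      contains the tile.\<close>
    have "k1 \<le> - int N - x" "int N + x \<le> k2" "l1 \<le> - int N" "int N \<le> l2"
      using boundX[of k1] boundX[of k2] boundY[of l1] boundY[of l2] k l x unfolding X_def by linarith+
    then show "(i, j, q) \<in> {k1..<k2} \<times> {l1..<l2} \<times> UNIV"
      using e x N by auto
    show "height X (psum \<omega>') (i, j, q) \<le> 1"
    proof -
      \<comment> \<open>These bounds make the height at most
        \<open>2 * (\<bar>m\<bar> + \<bar>n\<bar> + 4 - x)\<close>, whence the constant 4.\<close>
      have "- \<bar>m\<bar> - 2 \<le> psum \<omega> i" "- \<bar>m\<bar> - 2 \<le> psum \<omega> (i + 1)"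
        using e(2) boundX[of i] boundX[of "i + 1"] by linarith+
      moreover have "psum \<omega>' j \<le> \<bar>n\<bar> + 2" "psum \<omega>' (j + 1) \<le> \<bar>n\<bar> + 2"
        using e(3) boundY[of j] boundY[of "j + 1"] by linarith+
      ultimately show ?thesis using x by (cases q) (auto simp: X_def)
    qed
  qed
  then show ?thesis
    unfolding curve_through_def truchet_tiling_eq e .
qed

lemma AE_random_signs_pair:
  "AE (\<omega>, \<omega>') in random_signs p \<Otimes>\<^sub>M random_signs p'. (\<forall>k. \<omega> k \<in> {-1, 1}) \<and> (\<forall>k. \<omega>' k \<in> {-1, 1})"
  by (rule AE_I2) (auto simp: space_pair_measure random_signs_def sign_seq_space_def space_PiM PiE_iff)

theorem theorem2:
  fixes p p' :: real and a b :: plane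
  assumes "0 < p" "p < 1" "0 < p'" "p' < 1"
    and "square_edge a b"
  shows "AE (\<omega>, \<omega>') in random_signs p \<Otimes>\<^sub>M random_signs p'.
           closed_curve (curve_through (prod_sign \<omega> \<omega>') a b)"
proof -
  obtain m n :: int where a: "a = (real_of_int m + 1/2, real_of_int n + 1/2)"
    and b: "b = a + (1, 0) \<or> b = a + (0, 1)"
    using assms(5) by (auto simp: square_edge_def)
  define x where "x = \<bar>m\<bar> + \<bar>n\<bar> + 4"
  from AE_valley_pair[OF assms(1-4), of "nat x" x] AE_random_signs_pair show ?thesis
  proof eventually_elim
    case (elim z)
    obtain \<omega> \<omega>' where z: "z = (\<omega>, \<omega>')" by (cases z)
    obtain N where "nat x < N" "valley N x \<omega>" "valley N 0 (\<lambda>k. - \<omega>' k)"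
      using elim(1) by (auto simp: z)
    then show ?case
      using elim(2) unfolding z
      by (auto intro!: closed_curve_through_of_valleys[OF _ _ a b] simp: x_def)
  qed
qed

end
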